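(* Let $\beta\in(0,1)$, $0<T<\infty$, $u_0\in\mathbb R$, $Y>0$, and let $f:(0,T]\times[u_0-Y,u_0+Y]\to\mathbb R$. Assume there exist $L,\alpha,M>0$ such that for all $x\in(0,T]$ and all $y,\tilde y\in[u_0-Y,u_0+Y]$: (i) $f(\cdot,y)\in C(0,T]$; (ii) $|f(x,y)|\le Mx^{\alpha-\beta}$; (iii) $|f(x,y)-f(x,\tilde y)|\le Lx^{\alpha-\beta}|y-\tilde y|$. Then there exists a unique $u\in C_\beta[0,\widetilde T]$ solving $$\partial_0^\beta u(x)=f(x,u(x))\ \text{ for }x\in(0,\widetilde T],\qquad u(0)=u_0,$$ where either $\widetilde T=T$, or $\widetilde T\in(0,T)$ with $u(\widetilde T)\in\{u_0-Y,u_0+Y\}$. Furthermore, $u$ depends continuously on $u_0$ and $f$ in the following sense: if $f$ and $\tilde f$ both satisfy (ii) and (iii), and $u,\tilde u\in C_\beta[0,T]$ satisfy $\partial_0^\beta u=f(x,u)$ and $\partial_0^\beta\tilde u=\tilde f(x,\tilde u)$ on $(0,T]$ with $u(0)=\tilde u(0)=u_0$, then $\|u-\tilde u\|_{C[0,T]}\le C\varepsilon$, where $C$ depends only on $\alpha,\beta,L,T$, and $$\varepsilon=\sup\big\{x^{\beta-\alpha}|f(x,y)-\tilde f(x,y)|: x\in(0,T],\ y\in[u_0-Y,u_0+Y]\big\}.$$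
   Context: Fix $\beta\in(0,1)$. $C\cap L^1(0,T]$ is the set of continuous, Lebesgue integrable real functions on $(0,T]$. For $u\in C\cap L^1(0,T]$, $J_0^{1-\beta}u(x)=\int_0^x\frac{(x-r)^{-\beta}}{\Gamma(1-\beta)}u(r)\,dr$. Define $C_\beta(0,T]=\{u\in C\cap L^1(0,T]: J_0^{1-\beta}u\in C^1(0,T]\}$ and $C_\beta[0,T]=C[0,T]\cap C_\beta(0,T]$ (and likewise with $\widetilde T$ in place of $T$). For $u\in C_\beta(0,T]$, the censored fractional derivative is $$\partial_0^\beta u(x)=\frac{d}{dx}J_0^{1-\beta}u(x)-\frac{x^{-\beta}}{\Gamma(1-\beta)}u(x),\quad x\in(0,T].$$ Solving the equation with right-hand side $f(x,u(x))$ includes the requirement that $u$ takes values in $[u_0-Y,u_0+Y]$, the domain of $f(x,\cdot)$. Continuous dependence on $u_0$ is understood as the case $\tilde f(x,y)=f(x,y+\delta)$ of the stated estimate, where $\delta$ is the change in $u_0$. $\|\cdot\|_{C[0,T]}$ is the sup norm. *)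

theory Defs
  imports "HOL-Analysis.Analysis"
begin

text \<open>
  Functions on \<open>(0,T]\<close> or \<open>[0,T]\<close> are total functions \<open>real \<Rightarrow> real\<close>; every notion below depends only on
  their values on the interval in question.
\<close>

definition C_L1 :: "real \<Rightarrow> (real \<Rightarrow> real) set" where
  "C_L1 T = {u. continuous_on {0<..T} u \<and> set_integrable lborel {0<..T} u}"

text \<open>
  The operator \<open>J_0^{1-\<beta>}\<close>.  The argument is \<open>\<beta>\<close>, not the order \<open>1 - \<beta>\<close> of the integral.
\<close>

definition J0 :: "real \<Rightarrow> (real \<Rightarrow> real) \<Rightarrow> real \<Rightarrow> real" where
  "J0 \<beta> u x = (LBINT r:{0<..<x}. (x - r) powr (-\<beta>) / Gamma (1 - \<beta>) * u r)"

text \<open>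
  \<open>C^1(0,T]\<close>: the derivative at the endpoint \<open>T\<close> is the left derivative.  The library's
  \<open>C1_differentiable_on\<close> asks for two-sided derivatives at every point, and would therefore
  constrain the function beyond \<open>T\<close>.
\<close>

definition C1_left_open :: "real \<Rightarrow> (real \<Rightarrow> real) set" where
  "C1_left_open T = {F. \<exists>F'. continuous_on {0<..T} F' \<and>
     (\<forall>x\<in>{0<..T}. (F has_real_derivative F' x) (at x within {0<..T}))}"

definition C_beta_left_open :: "real \<Rightarrow> real \<Rightarrow> (real \<Rightarrow> real) set" where
  "C_beta_left_open \<beta> T = {u \<in> C_L1 T. J0 \<beta> u \<in> C1_left_open T}"

definition C_beta :: "real \<Rightarrow> real \<Rightarrow> (real \<Rightarrow> real) set" where
  "C_beta \<beta> T = {u. continuous_on {0..T} u} \<inter> C_beta_left_open \<beta> T"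

text \<open>
  The parameter \<open>T\<close> only serves to make the derivative one-sided at \<open>x = T\<close>.
\<close>

definition censored_deriv :: "real \<Rightarrow> real \<Rightarrow> (real \<Rightarrow> real) \<Rightarrow> real \<Rightarrow> real" where
  "censored_deriv \<beta> T u x =
     vector_derivative (J0 \<beta> u) (at x within {0<..T}) - x powr (-\<beta>) / Gamma (1 - \<beta>) * u x"

definition solves_ivp ::
    "real \<Rightarrow> real \<Rightarrow> real \<Rightarrow> real \<Rightarrow> (real \<Rightarrow> real \<Rightarrow> real) \<Rightarrow> (real \<Rightarrow> real) \<Rightarrow> bool" where
  "solves_ivp \<beta> T u0 Y f u \<longleftrightarrow>
     u \<in> C_beta \<beta> T \<and>
     (\<forall>x\<in>{0..T}. u x \<in> {u0 - Y..u0 + Y}) \<and>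
     (\<forall>x\<in>{0<..T}. censored_deriv \<beta> T u x = f x (u x)) \<and>
     u 0 = u0"

definition growth_cond ::
    "real \<Rightarrow> real \<Rightarrow> real \<Rightarrow> real \<Rightarrow> real \<Rightarrow> real \<Rightarrow> (real \<Rightarrow> real \<Rightarrow> real) \<Rightarrow> bool" where
  "growth_cond \<alpha> \<beta> M T u0 Y f \<longleftrightarrow>
     (\<forall>x\<in>{0<..T}. \<forall>y\<in>{u0 - Y..u0 + Y}. \<bar>f x y\<bar> \<le> M * x powr (\<alpha> - \<beta>))"

definition lipschitz_cond ::
    "real \<Rightarrow> real \<Rightarrow> real \<Rightarrow> real \<Rightarrow> real \<Rightarrow> real \<Rightarrow> (real \<Rightarrow> real \<Rightarrow> real) \<Rightarrow> bool" where
  "lipschitz_cond \<alpha> \<beta> L T u0 Y f \<longleftrightarrow>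
     (\<forall>x\<in>{0<..T}. \<forall>y\<in>{u0 - Y..u0 + Y}. \<forall>y'\<in>{u0 - Y..u0 + Y}.
        \<bar>f x y - f x y'\<bar> \<le> L * x powr (\<alpha> - \<beta>) * \<bar>y - y'\<bar>)"

end

theory Submission
  imports Defs "HOL-Probability.Probability_Measure"
begin

text \<open>
  Let \<open>B\<close> be a random variable with the \<open>Beta(1 - \<beta>, \<beta>)\<close> distribution. Since \<open>J\<^sub>0\<^sup>\<beta>\<close> and \<open>J\<^sub>0\<^sup>1\<^sup>-\<^sup>\<beta>\<close>
  compose to ordinary integration, the equation is equivalent to the fixed point equation
  \<open>u(x) = E[u(xB) + G(xB, u(xB))]\<close> with \<open>G(y, z) = \<Gamma>(1 - \<beta>) y\<^sup>\<beta> f(y, z) = O(y\<^sup>\<alpha>)\<close>.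
  Averaging against \<open>B\<close> fixes constants, but it contracts \<open>y\<^sup>\<alpha>\<close> by the factor \<open>E[B\<^sup>\<alpha>] < 1\<close>, and in the weight
  \<open>x\<^sup>\<alpha> exp(kx)\<close> with \<open>k\<close> large the Lipschitz perturbation \<open>G\<close> does not spoil the contraction.
  Picard iteration from the constant \<open>u\<^sub>0\<close> therefore converges. Conversely, a maximum principle for the
  averaging operator shows that the difference of two solutions is \<open>O(x\<^sup>\<alpha>)\<close>, so the contraction also
  applies to it and gives uniqueness and continuous dependence. The constraint on the range of \<open>u\<close> is
  handled by clamping the second argument of \<open>f\<close> and stopping at the first exit time.
\<close>

section \<open>The Abel kernel\<close>

text \<open>Euler's integral in Bochner form. It normalises both the Abel kernel and the beta
  density, and it supplies the integrability of the singular powers met later.\<close>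

lemma has_bochner_integral_Beta:
  fixes a b :: real
  assumes "0 < a" "0 < b"
  shows "has_bochner_integral lborel
    (\<lambda>t. indicator {0<..<1} t * (t powr (a - 1) * (1 - t) powr (b - 1))) (Beta a b)"
proof -
  have "set_integrable lborel {0<..<1} (\<lambda>t::real. t powr (a - 1) * (1 - t) powr (b - 1))"
    by (rule set_integrable_subset[OF integrable_Beta[OF assms]]) auto
  moreover have "((\<lambda>t::real. t powr (a - 1) * (1 - t) powr (b - 1)) has_integral Beta a b) {0<..<1}"
    using has_integral_Beta_real[OF assms] by (simp add: has_integral_Icc_iff_Ioo)
  ultimately show ?thesis
    using set_borel_integral_eq_integral(2)[of "{0<..<1}" "\<lambda>t::real. t powr (a - 1) * (1 - t) powr (b - 1)"]
    by (simp add: has_bochner_integral_iff set_integrable_def set_lebesgue_integral_def integral_unique)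
qed

text \<open>Substituting \<open>s = r + (x - r) * t\<close> turns the kernel into the integrand of
  \<open>Beta a (1 - a)\<close>. The exponents \<open>-a\<close> and \<open>a - 1\<close> of
  \<open>x - r\<close> add up to -1, which cancels the Jacobian, so the value depends neither on
  \<open>r\<close> nor on \<open>x\<close>.\<close>

lemma has_bochner_integral_Abel_kernel:
  fixes a r x :: real
  assumes a: "0 < a" "a < 1" and "r < x"
  shows "has_bochner_integral lborel
    (\<lambda>s. if r < s \<and> s < x then (x - s) powr (-a) * (s - r) powr (a - 1) else 0)
    (Gamma a * Gamma (1 - a))"
proof -
  have *: "(if r < r + (x - r) * t \<and> r + (x - r) * t < x
           then (x - (r + (x - r) * t)) powr (-a) * (r + (x - r) * t - r) powr (a - 1) else 0)
         = (indicator {0<..<1} t * (t powr (a - 1) * (1 - t) powr ((1 - a) - 1))) /\<^sub>R \<bar>x - r\<bar>" for t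
  proof (cases "0 < t \<and> t < 1")
    case True
    with \<open>r < x\<close> have lt: "r + (x - r) * t < x"
      using mult_strict_left_mono[of t 1 "x - r"] by (simp add: algebra_simps)
    have e: "x - (r + (x - r) * t) = (x - r) * (1 - t)" by (simp add: algebra_simps)
    have "(x - r) powr (-a) * (x - r) powr (a - 1) = inverse (x - r)"
      using \<open>r < x\<close> by (simp only: powr_add[symmetric]) (simp add: powr_minus)
    moreover have "((x - r) * (1 - t)) powr (-a) * (r + (x - r) * t - r) powr (a - 1)
        = ((x - r) powr (-a) * (x - r) powr (a - 1)) * (t powr (a - 1) * (1 - t) powr (- a))"
      using True \<open>r < x\<close> by (simp add: powr_mult)
    ultimately show ?thesis
      using True \<open>r < x\<close> lt unfolding e by simp
  next
    case False
    have "\<not> (r < r + (x - r) * t \<and> r + (x - r) * t < x)"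
    proof (cases "t \<le> 0")
      case True
      then show ?thesis using \<open>r < x\<close> by (auto simp: zero_less_mult_iff)
    next
      case False
      with \<open>\<not> (0 < t \<and> t < 1)\<close> have "(x - r) * 1 \<le> (x - r) * t"
        using \<open>r < x\<close> by (intro mult_left_mono) auto
      then show ?thesis by simp
    qed
    with False show ?thesis by auto
  qed
  have "Beta a (1 - a) = Gamma a * Gamma (1 - a)" by (simp add: Beta_def)
  with has_bochner_integral_Beta[of a "1 - a"] a
  have B: "has_bochner_integral lborel
      (\<lambda>t. indicator {0<..<1} t * (t powr (a - 1) * (1 - t) powr ((1 - a) - 1))) (Gamma a * Gamma (1 - a))"
    by simp
  have "x - r \<noteq> 0" using \<open>r < x\<close> by simp
  then show ?thesis
    using has_bochner_integral_scaleR_right[OF B, of "inverse \<bar>x - r\<bar>"]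
    by (subst lborel_has_bochner_integral_real_affine_iff[of "x - r" _ _ r]) (simp_all only: * not_False_eq_True)
qed

text \<open>The two operators have the complementary orders \<open>1 - a\<close> and
  \<open>a\<close>. After exchanging the integrals, the inner one is the Abel kernel, whose constant
  value is cancelled by the two Gamma factors.\<close>

lemma J0_J0:
  fixes a x :: real
  assumes a: "0 < a" "a < 1" and h: "set_integrable lborel {0<..<x} h"
  shows "J0 a (J0 (1 - a) h) x = (LBINT r:{0<..<x}. h r)"
proof -
  define H where "H r = indicator {0<..<x} r * h r" for r
  define c where "c = Gamma a * Gamma (1 - a)"
  have c: "c > 0" using a by (simp add: c_def Gamma_real_pos)
  have H: "integrable lborel H" using h by (simp add: set_integrable_def H_def[abs_def])
  have Hm[measurable]: "H \<in> borel_measurable borel" using borel_measurable_integrable[OF H] by simp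
  define k where "k r s = (if r < s \<and> s < x then (x - s) powr (-a) * (s - r) powr (a - 1) else 0)" for r s
  have km[measurable]: "case_prod k \<in> borel_measurable (borel \<Otimes>\<^sub>M borel)"
    unfolding k_def by measurable
  have kint: "has_bochner_integral lborel (k r) c" if "r < x" for r
    using has_bochner_integral_Abel_kernel[OF a that] by (simp add: k_def[abs_def] c_def)
  have knn: "k r s \<ge> 0" for r s by (simp add: k_def)
  \<comment> \<open>\<open>kint\<close> only covers \<open>r < x\<close>; for the remaining
    \<open>r\<close> the factor \<open>H r\<close> vanishes, so the inner integrals below are known
    for every real \<open>r\<close>.\<close>
  have H0: "H r = 0" if "\<not> r < x" for r using that by (simp add: H_def)
  have inner: "integrable lborel (\<lambda>s. H r * k r s)" "(LBINT s. H r * k r s) = c * H r" for r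
    using kint[of r] H0[of r] by (cases "r < x"; simp add: has_bochner_integral_iff)+
  have inner_abs: "(LBINT s. norm (H r * k r s)) = c * \<bar>H r\<bar>" for r
    using kint[of r] H0[of r] knn
    by (cases "r < x") (auto simp: has_bochner_integral_iff abs_mult)
  have "integrable (lborel \<Otimes>\<^sub>M lborel) (\<lambda>(r, s). H r * k r s)"
  proof (rule lborel_pair.Fubini_integrable)
    show "(\<lambda>(r, s). H r * k r s) \<in> borel_measurable (lborel \<Otimes>\<^sub>M lborel)" by measurable
    show "integrable lborel (\<lambda>r. LBINT s. norm (case (r, s) of (r, s) \<Rightarrow> H r * k r s))"
      unfolding prod.case inner_abs using H by simp
    show "AE r in lborel. integrable lborel (\<lambda>s. case (r, s) of (r, s) \<Rightarrow> H r * k r s)"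
      unfolding prod.case using inner(1) by (intro AE_I2)
  qed
  from lborel_pair.Fubini_integral[OF this]
  have F: "(LBINT s. LBINT r. H r * k r s) = c * (LBINT r. H r)"
    unfolding inner(2) by simp
  have "J0 a (J0 (1 - a) h) x = (LBINT s. (LBINT r. H r * k r s) / c)"
    unfolding J0_def set_lebesgue_integral_def
  proof (rule Bochner_Integration.integral_cong[OF refl])
    fix s
    have "(LBINT r. H r * k r s) =
      (LBINT r. indicator {0<..<x} s * (x - s) powr (-a) * (indicator {0<..<s} r * ((s - r) powr (a - 1) * h r)))"
      by (rule Bochner_Integration.integral_cong) (auto simp: H_def k_def indicator_def)
    also have "\<dots> = indicator {0<..<x} s * (x - s) powr (-a) *
       (LBINT r. indicator {0<..<s} r * ((s - r) powr (a - 1) * h r))" by simp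
    finally show "indicator {0<..<x} s *\<^sub>R ((x - s) powr - a / Gamma (1 - a) *
         (LBINT r. indicator {0<..<s} r *\<^sub>R ((s - r) powr - (1 - a) / Gamma (1 - (1 - a)) * h r))) =
        (LBINT r. H r * k r s) / c"
      by (simp add: c_def mult.commute mult.left_commute)
  qed
  also have "\<dots> = (LBINT r. H r)" using c by (simp add: F)
  also have "\<dots> = (LBINT r:{0<..<x}. h r)" by (simp add: set_lebesgue_integral_def H_def)
  finally show ?thesis .
qed

text \<open>Substituting \<open>r = x * s\<close> pulls the homogeneity
  \<open>x powr (1 - b)\<close> of the kernel out. This gives the decay of \<open>J0\<close> at 0
  and the comparison with averages over the fixed interval (0,1).\<close>

lemma J0_scale:
  assumes "0 < x"
  shows "J0 b u x = x powr (1 - b) / Gamma (1 - b) * (LBINT s:{0<..<1}. (1 - s) powr (-b) * u (x * s))"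
proof -
  have "J0 b u x = x * (LBINT s. indicator {0<..<x} (0 + x * s) *\<^sub>R
      ((x - (0 + x * s)) powr - b / Gamma (1 - b) * u (0 + x * s)))"
    unfolding J0_def set_lebesgue_integral_def
    by (subst lborel_integral_real_affine[of x _ 0]) (use assms in auto)
  also have "\<dots> = x * (LBINT s. x powr (-b) / Gamma (1 - b) * (indicator {0<..<1} s * ((1 - s) powr (-b) * u (x * s))))"
  proof (intro arg_cong2[where f="(*)"] refl Bochner_Integration.integral_cong)
    fix s
    have i: "indicator {0<..<x} (0 + x * s) = (indicator {0<..<1} s :: real)"
      using assms by (auto simp: indicator_def zero_less_mult_iff)
    have "x - x * s = x * (1 - s)" by (simp add: algebra_simps)
    then have "(x - x * s) powr (-b) = x powr (-b) * (1 - s) powr (-b)" if "s \<in> {0<..<1}"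
      using that assms by (simp add: powr_mult)
    then show "indicator {0<..<x} (0 + x * s) *\<^sub>R
      ((x - (0 + x * s)) powr - b / Gamma (1 - b) * u (0 + x * s)) =
      x powr (-b) / Gamma (1 - b) * (indicator {0<..<1} s * ((1 - s) powr (-b) * u (x * s)))"
      unfolding i by (cases "s \<in> {0<..<1}") auto
  qed
  also have "\<dots> = x powr (1 - b) / Gamma (1 - b) * (LBINT s:{0<..<1}. (1 - s) powr (-b) * u (x * s))"
  proof -
    have "x powr (1 - b) = x * x powr (-b)" using assms by (simp add: powr_diff powr_minus divide_inverse)
    then show ?thesis by (simp add: set_lebesgue_integral_def)
  qed
  finally show ?thesis .
qed

section \<open>Averages against a beta distribution\<close>

lemma continuous_on_Icc_bounded:
  fixes f :: "real \<Rightarrow> real"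
  assumes "continuous_on {a..b} f"
  obtains C where "0 \<le> C" "\<And>x. x \<in> {a..b} \<Longrightarrow> \<bar>f x\<bar> \<le> C"
proof -
  obtain C where "\<And>x. x \<in> {a..b} \<Longrightarrow> norm (f x) \<le> C"
    using compact_imp_bounded[OF compact_continuous_image[OF assms]] unfolding bounded_iff by blast
  then show ?thesis by (intro that[of "max C 0"]) fastforce+
qed

text \<open>The normalising constant is \<open>Beta (1 - b) b\<close>, because Gamma(1) = 1.\<close>

definition beta_density :: "real \<Rightarrow> real \<Rightarrow> real" where
  "beta_density b s = s powr (-b) * (1 - s) powr (b - 1) / (Gamma b * Gamma (1 - b))"

text \<open>Restricting the space to the open interval, rather than putting an indicator into the
  density, lets almost-everywhere claims be checked pointwise for \<open>0 < s < 1\<close>.\<close>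

definition beta_measure :: "real \<Rightarrow> real measure" where
  "beta_measure b = density (restrict_space lborel {0<..<1}) (\<lambda>s. ennreal (beta_density b s))"

text \<open>\<open>beta_avg b g x = E[g(xB)]\<close> with \<open>B\<close> distributed as \<open>Beta(1 - b, b)\<close>.\<close>

definition beta_avg :: "real \<Rightarrow> (real \<Rightarrow> real) \<Rightarrow> real \<Rightarrow> real" where
  "beta_avg b g x = (\<integral>s. g (x * s) \<partial>beta_measure b)"

lemma space_beta_measure [simp]: "space (beta_measure b) = {0<..<1}"
  by (simp add: beta_measure_def space_restrict_space)

lemma borel_measurable_beta_measure:
  assumes "continuous_on {0<..<1} f"
  shows "f \<in> borel_measurable (beta_measure b)"
proof -
  have "sets (beta_measure b) = sets (restrict_space borel {0<..<1})"
    by (simp add: beta_measure_def sets_restrict_space)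
  then show ?thesis
    using borel_measurable_continuous_on_restrict[OF assms] measurable_cong_sets by blast
qed

locale fractional_order =
  fixes b :: real
  assumes b: "0 < b" "b < 1"
begin

lemma Gamma_order_nonzero: "Gamma b \<noteq> 0" "Gamma (1 - b) \<noteq> 0"
  using b Gamma_real_pos[of b] Gamma_real_pos[of "1 - b"] by linarith+

lemma beta_density_pos: "s \<in> {0<..<1} \<Longrightarrow> 0 < beta_density b s"
  using b by (simp add: beta_density_def Gamma_real_pos)

lemma beta_density_measurable [measurable]: "beta_density b \<in> borel_measurable borel"
  unfolding beta_density_def[abs_def] by measurable

lemma integral_beta_measure:
  assumes "continuous_on {0<..<1} f"
  shows "(\<integral>s. f s \<partial>beta_measure b) = (LBINT s:{0<..<1}. beta_density b s * f s)"
proof -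
  have "f \<in> borel_measurable (restrict_space lborel {0<..<1})"
    using borel_measurable_continuous_on_restrict[OF assms]
    by (subst measurable_cong_sets[OF sets_restrict_space_cong[OF sets_lborel] refl])
  then show ?thesis
    unfolding beta_measure_def set_lebesgue_integral_def
    by (subst integral_density)
       (auto simp: integral_restrict_space measurable_restrict_space1 AE_restrict_space_iff
             intro!: AE_I2 less_imp_le[OF beta_density_pos])
qed

text \<open>Total mass one is Euler's integral again. It is the reason why averaging fixes
  constants.\<close>

lemma prob_space_beta_measure: "prob_space (beta_measure b)"
proof
  have B: "has_bochner_integral lborel (\<lambda>s. indicator {0<..<1} s * beta_density b s) 1"
    using has_bochner_integral_divide_zero[OF has_bochner_integral_Beta[of "1 - b" b], of "Gamma b * Gamma (1 - b)"] b Gamma_order_nonzero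
    by (simp add: beta_density_def[abs_def] Beta_def)
  have "emeasure (beta_measure b) (space (beta_measure b)) =
      (\<integral>\<^sup>+s. ennreal (beta_density b s) \<partial>restrict_space lborel {0<..<1})"
    unfolding space_beta_measure beta_measure_def
    by (subst emeasure_density)
       (auto simp: measurable_restrict_space1 sets_restrict_space space_restrict_space
         intro!: nn_integral_cong)
  also have "\<dots> = (\<integral>\<^sup>+s. ennreal (indicator {0<..<1} s * beta_density b s) \<partial>lborel)"
    by (subst nn_integral_restrict_space) (auto intro!: nn_integral_cong simp: indicator_def)
  also have "\<dots> = ennreal 1"
    using B beta_density_pos
    by (subst nn_integral_eq_integral)
       (auto simp: has_bochner_integral_iff indicator_def intro!: AE_I2 less_imp_le)
  finally show "emeasure (beta_measure b) (space (beta_measure b)) = 1" by simp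
qed

sublocale beta: prob_space "beta_measure b"
  by (rule prob_space_beta_measure)

lemma scaled_mem_Icc:
  fixes x :: real
  assumes "x \<in> {0..T}" "s \<in> {0..1}"
  shows "x * s \<in> {0..T}"
  using assms mult_left_le[of s x] by (auto intro: order_trans)

lemma continuous_on_scaled:
  fixes g :: "real \<Rightarrow> real"
  assumes "continuous_on {0..T} g" "x \<in> {0..T}"
  shows "continuous_on {0..1} (\<lambda>s. g (x * s))"
proof (intro continuous_on_compose2[OF assms(1)] continuous_intros)
  show "(\<lambda>s. x * s) ` {0..1} \<subseteq> {0..T}"
    using scaled_mem_Icc[OF assms(2)] by blast
qed

lemma integrable_beta_measure:
  fixes f :: "real \<Rightarrow> real"
  assumes "continuous_on {0..1} f"
  shows "integrable (beta_measure b) f"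
proof -
  obtain C where "\<And>s. s \<in> {0..1} \<Longrightarrow> \<bar>f s\<bar> \<le> C"
    using continuous_on_Icc_bounded[OF assms] by blast
  then show ?thesis
    by (intro beta.integrable_const_bound[of _ C] AE_I2 borel_measurable_beta_measure)
       (auto intro: continuous_on_subset[OF assms])
qed

lemma integrable_beta_avg:
  fixes g :: "real \<Rightarrow> real"
  assumes "continuous_on {0..T} g" "x \<in> {0..T}"
  shows "integrable (beta_measure b) (\<lambda>s. g (x * s))"
  by (rule integrable_beta_measure[OF continuous_on_scaled[OF assms]])

section \<open>Linearity, order and continuity of the averaging operator\<close>

lemma beta_avg_const [simp]: "beta_avg b (\<lambda>_. c) x = c"
  by (simp add: beta_avg_def beta.prob_space[unfolded space_beta_measure])

lemma beta_avg_zero [simp]: "beta_avg b g 0 = g 0"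
  by (simp add: beta_avg_def beta.prob_space[unfolded space_beta_measure])

lemma beta_avg_add:
  assumes "continuous_on {0..T} g" "continuous_on {0..T} h" "x \<in> {0..T}"
  shows "beta_avg b (\<lambda>y. g y + h y) x = beta_avg b g x + beta_avg b h x"
  unfolding beta_avg_def by (intro Bochner_Integration.integral_add integrable_beta_avg[of T] assms)

lemma beta_avg_diff:
  assumes "continuous_on {0..T} g" "continuous_on {0..T} h" "x \<in> {0..T}"
  shows "beta_avg b (\<lambda>y. g y - h y) x = beta_avg b g x - beta_avg b h x"
  unfolding beta_avg_def by (intro Bochner_Integration.integral_diff integrable_beta_avg[of T] assms)

lemma beta_avg_mult_left: "beta_avg b (\<lambda>y. c * g y) x = c * beta_avg b g x"
  unfolding beta_avg_def by simp

text \<open>The average at \<open>x\<close> only sees the values on (0,x), so a comparison on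
  \<open>{0..x}\<close> is enough.\<close>

lemma beta_avg_mono:
  assumes "continuous_on {0..T} g" "continuous_on {0..T} h" "x \<in> {0..T}"
    and "\<And>y. y \<in> {0..x} \<Longrightarrow> g y \<le> h y"
  shows "beta_avg b g x \<le> beta_avg b h x"
  unfolding beta_avg_def
proof (intro integral_mono integrable_beta_avg[of T] assms)
  fix s assume "s \<in> space (beta_measure b)"
  then show "x * s \<in> {0..x}" using assms(3) mult_left_le[of s x] by auto
qed

lemma abs_beta_avg_le:
  "\<bar>beta_avg b g x\<bar> \<le> beta_avg b (\<lambda>y. \<bar>g y\<bar>) x"
  unfolding beta_avg_def by (rule integral_abs_bound)

text \<open>Dominated convergence along sequences; a constant bound of \<open>g\<close> is an
  integrable majorant on a probability space.\<close>

lemma continuous_on_beta_avg: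
  assumes g: "continuous_on {0..T} g"
  shows "continuous_on {0..T} (beta_avg b g)"
proof -
  obtain C where C: "\<And>y. y \<in> {0..T} \<Longrightarrow> \<bar>g y\<bar> \<le> C"
    using continuous_on_Icc_bounded[OF g] by blast
  have sub: "x * s \<in> {0..T}" if "x \<in> {0..T}" "s \<in> {0<..<1}" for x s
    using that by (intro scaled_mem_Icc) auto
  show ?thesis
    unfolding continuous_on_sequentially
  proof (intro allI ballI impI)
    fix X x assume x: "x \<in> {0..T}" and X: "(\<forall>n. X n \<in> {0..T}) \<and> X \<longlonglongrightarrow> x"
    show "(beta_avg b g \<circ> X) \<longlonglongrightarrow> beta_avg b g x"
      unfolding comp_def beta_avg_def
    proof (rule integral_dominated_convergence[where w="\<lambda>_. C"])
      show "AE s in beta_measure b. (\<lambda>n. g (X n * s)) \<longlonglongrightarrow> g (x * s)"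
      proof (rule AE_I2)
        fix s assume "s \<in> space (beta_measure b)"
        then have s: "s \<in> {0<..<1}" by simp
        have "(\<lambda>n. X n * s) \<longlonglongrightarrow> x * s" using X by (intro tendsto_intros) auto
        then show "(\<lambda>n. g (X n * s)) \<longlonglongrightarrow> g (x * s)"
          using continuous_on_tendsto_compose[OF g, of "\<lambda>n. X n * s"] sub[OF _ s] x X by auto
      qed
      show "AE s in beta_measure b. norm (g (X n * s)) \<le> C" for n
        by (rule AE_I2) (use C sub X in auto)
      show "(\<lambda>s. g (x * s)) \<in> borel_measurable (beta_measure b)"
        "\<And>n. (\<lambda>s. g (X n * s)) \<in> borel_measurable (beta_measure b)"
        using integrable_beta_avg[OF g] x X by (auto dest: borel_measurable_integrable)
    qed simp
  qed
qed

text \<open>Minimality of the maximum point \<open>z\<close> makes \<open>\<phi> < \<phi> z\<close> on the whole of \<open>(0, z)\<close>, so the average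
  at \<open>z\<close> is strictly smaller than \<open>\<phi> z\<close>.\<close>

lemma beta_avg_max_principle:
  assumes \<phi>: "continuous_on {0..T} \<phi>" and "\<phi> 0 = 0" and x: "x \<in> {0..T}"
    and sub: "\<And>x. x \<in> {0<..T} \<Longrightarrow> \<phi> x \<le> beta_avg b \<phi> x"
  shows "\<phi> x \<le> 0"
proof -
  obtain m where m: "m \<in> {0..T}" "\<And>y. y \<in> {0..T} \<Longrightarrow> \<phi> y \<le> \<phi> m"
    using continuous_attains_sup[OF _ _ \<phi>] x by fastforce
  define S where "S = {y \<in> {0..T}. \<phi> y = \<phi> m}"
  have "closed S" unfolding S_def
    by (intro continuous_closed_preimage_constant \<phi>) auto
  then have "compact S"
    using compact_Int_closed[of "{0..T}" S] Int_absorb1[of S "{0..T}"] by (simp add: S_def subset_iff)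
  then obtain z where z: "z \<in> S" "\<And>y. y \<in> S \<Longrightarrow> z \<le> y"
    using compact_attains_inf[of S] m by (auto simp: S_def)
  have zT: "z \<in> {0..T}" "\<phi> z = \<phi> m" using z by (auto simp: S_def)
  have "z = 0"
  proof (rule ccontr)
    assume "z \<noteq> 0"
    with zT have z0: "z \<in> {0<..T}" by auto
    have "beta_avg b \<phi> z < (\<integral>s. \<phi> z \<partial>beta_measure b)"
      unfolding beta_avg_def
    proof (rule beta.integral_less_AE_space)
      show "AE s in beta_measure b. \<phi> (z * s) < \<phi> z"
      proof (rule AE_I2)
        fix s assume "s \<in> space (beta_measure b)"
        then have "0 < z * s" and s: "z * s < z"
          using z0 mult_strict_left_mono[of s 1 z] by auto
        then have sT: "z * s \<in> {0..T}" using z0 by auto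
        have "z * s \<notin> S" using z(2)[of "z * s"] s by auto
        then show "\<phi> (z * s) < \<phi> z" using m(2)[OF sT] sT zT by (auto simp: S_def)
      qed
      show "integrable (beta_measure b) (\<lambda>s. \<phi> (z * s))" by (rule integrable_beta_avg[OF \<phi> zT(1)])
    qed (simp_all add: beta.emeasure_space_1[unfolded space_beta_measure])
    then show False using sub[OF z0] by (simp add: beta.prob_space[unfolded space_beta_measure])
  qed
  then show ?thesis using m(2)[OF x] zT \<open>\<phi> 0 = 0\<close> by simp
qed

end

section \<open>Contraction, comparison and fixed points\<close>

text \<open>A positive exponent keeps \<open>powr\<close> continuous where the base vanishes, which
  covers the endpoint 0 of \<open>{0..T}\<close>.\<close>

lemma continuous_on_powr_pos [continuous_intros]:
  fixes f :: "'a::topological_space \<Rightarrow> real"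
  assumes "continuous_on S f" "\<And>x. x \<in> S \<Longrightarrow> 0 \<le> f x" "0 < p"
  shows "continuous_on S (\<lambda>x. f x powr p)"
  using assms by (intro continuous_on_powr') auto

context fractional_order
begin

text \<open>Powers are eigenfunctions of averaging; the eigenvalue is the moment E[B^p].\<close>

lemma beta_avg_powr:
  assumes "0 \<le> x"
  shows "beta_avg b (\<lambda>y. y powr p) x = x powr p * beta_avg b (\<lambda>y. y powr p) 1"
proof -
  have "beta_avg b (\<lambda>y. y powr p) x = (\<integral>s. x powr p * s powr p \<partial>beta_measure b)"
    unfolding beta_avg_def
    using assms by (intro Bochner_Integration.integral_cong refl) (simp add: powr_mult)
  then show ?thesis by (simp add: beta_avg_def)
qed

text \<open>The spectral gap: \<open>s powr p < 1\<close> at every point of the open interval, and a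
  strict inequality survives integration against a probability measure.\<close>

lemma beta_moment:
  assumes "0 < p"
  shows "0 \<le> beta_avg b (\<lambda>y. y powr p) 1" "beta_avg b (\<lambda>y. y powr p) 1 < 1"
proof -
  show "0 \<le> beta_avg b (\<lambda>y. y powr p) 1" unfolding beta_avg_def by simp
  have "(\<integral>s. (1 * s) powr p \<partial>beta_measure b) < (\<integral>s. 1 \<partial>beta_measure b)"
  proof (rule beta.integral_less_AE_space)
    show "AE s in beta_measure b. (1 * s) powr p < 1"
      using assms powr_less_mono2[of p _ 1] by (intro AE_I2) auto
    show "integrable (beta_measure b) (\<lambda>s. (1 * s) powr p)"
      using assms by (intro integrable_beta_measure continuous_intros) auto
  qed (simp_all add: beta.emeasure_space_1[unfolded space_beta_measure])
  then show "beta_avg b (\<lambda>y. y powr p) 1 < 1"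
    by (simp add: beta_avg_def beta.prob_space[unfolded space_beta_measure])
qed

text \<open>Since \<open>1 - s\<close> is positive on the whole space, the integrand tends to 0
  pointwise and is bounded by 1.\<close>

lemma exp_decay_beta_measure:
  assumes "0 < d"
  shows "(\<lambda>n. \<integral>s. exp (- (real n * d * (1 - s))) \<partial>beta_measure b) \<longlonglongrightarrow> 0"
proof -
  have "(\<lambda>n. \<integral>s. exp (- (real n * d * (1 - s))) \<partial>beta_measure b) \<longlonglongrightarrow> (\<integral>s. 0 \<partial>beta_measure b)"
  proof (rule integral_dominated_convergence[where w="\<lambda>_. 1"])
    show "AE s in beta_measure b. (\<lambda>n. exp (- (real n * d * (1 - s)))) \<longlonglongrightarrow> 0"
    proof (rule AE_I2)
      fix s assume "s \<in> space (beta_measure b)"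
      then have "0 < d * (1 - s)" using assms by simp
      then have "exp (- (d * (1 - s))) < 1" by simp
      then have "(\<lambda>n. exp (- (d * (1 - s))) ^ n) \<longlonglongrightarrow> 0"
        by (intro LIMSEQ_power_zero) simp
      then show "(\<lambda>n. exp (- (real n * d * (1 - s)))) \<longlonglongrightarrow> 0"
        by (simp add: exp_of_nat_mult[symmetric] mult.assoc)
    qed
    show "AE s in beta_measure b. norm (exp (- (real n * d * (1 - s)))) \<le> 1" for n
      using assms by (intro AE_I2) simp
    show "(\<lambda>s. exp (- (real n * d * (1 - s)))) \<in> borel_measurable (beta_measure b)" for n
      by (intro borel_measurable_beta_measure continuous_intros)
  qed simp_all
  then show ?thesis by simp
qed

text \<open>For \<open>x\<close> near \<open>0\<close> the factor \<open>1 + L x\<^sup>p\<close> is absorbed by the spectral gap \<open>E[B\<^sup>p] < 1\<close>; away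
  from \<open>0\<close> the exponential weight makes the average small.\<close>

lemma beta_avg_contraction:
  assumes p: "0 < p" and L: "0 \<le> L" and T: "0 < T"
  obtains k q where "0 \<le> k" "0 \<le> q" "q < 1"
    "\<And>x. x \<in> {0..T} \<Longrightarrow> beta_avg b (\<lambda>y. (1 + L * y powr p) * (y powr p * exp (k * y))) x
       \<le> q * (x powr p * exp (k * x))"
proof -
  define l where "l = beta_avg b (\<lambda>y. y powr p) 1"
  have l: "0 \<le> l" "l < 1" using beta_moment[OF p] by (simp_all add: l_def)
  \<comment> \<open>\<open>q\<close> is the midpoint between the eigenvalue \<open>l\<close> and 1,
    and \<open>h\<close> bounds the size of \<open>x powr p\<close> for which
    \<open>(1 + L * h) * l\<close> still stays below \<open>q\<close>. The term \<open>L + 1\<close>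
    in the denominator admits \<open>L = 0\<close>.\<close>
  define q where "q = (1 + l) / 2"
  have q: "0 \<le> q" "q < 1" "1/2 \<le> q" using l by (simp_all add: q_def)
  define h where "h = (1 - l) / (2 * (L + 1))"
  have h: "0 < h" using l L by (simp add: h_def)
  have "L * h \<le> (1 - l) / 2"
    using l L by (simp add: h_def field_simps)
  then have "l * (L * h) \<le> 1 * ((1 - l) / 2)" using l h L by (intro mult_mono) auto
  then have lh: "(1 + L * h) * l \<le> q" by (simp add: q_def algebra_simps)
  define d where "d = h powr (1 / p)"
  have d: "0 < d" "d powr p = h" using h p by (simp_all add: d_def powr_powr)
  \<comment> \<open>\<open>D\<close> is the largest Lipschitz factor on \<open>{0..T}\<close>. For
    \<open>x > d\<close> the exponential decay has to beat it with a result of at most 1/2, which is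
    at most \<open>q\<close>.\<close>
  define D where "D = 1 + L * T powr p"
  have D: "1 \<le> D" using L by (simp add: D_def)
  have "\<forall>\<^sub>F n in sequentially. (\<integral>s. exp (- (real n * d * (1 - s))) \<partial>beta_measure b) < 1 / (2 * D)"
    by (rule order_tendstoD[OF exp_decay_beta_measure[OF d(1)]]) (use D in auto)
  then obtain n where n: "(\<integral>s. exp (- (real n * d * (1 - s))) \<partial>beta_measure b) < 1 / (2 * D)"
    unfolding eventually_sequentially by blast
  define k where "k = real n"
  define W where "W y = y powr p * exp (k * y)" for y
  have bound: "beta_avg b (\<lambda>y. (1 + L * y powr p) * W y) x \<le> q * W x" if x: "x \<in> {0..T}" for x
  proof -
    have int: "integrable (beta_measure b) (\<lambda>s. (1 + L * (x * s) powr p) * W (x * s))"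
      unfolding W_def using x p
      by (intro integrable_beta_measure continuous_intros) auto
    have Wx: "0 \<le> W x" by (simp add: W_def)
    have xs: "0 \<le> x * s" "x * s \<le> x" if "s \<in> {0<..<1}" for s
      using that x mult_left_le[of s x] by auto
    show ?thesis
    proof (cases "x \<le> d")
      case True
      have "beta_avg b (\<lambda>y. (1 + L * y powr p) * W y) x
          \<le> (\<integral>s. (1 + L * h) * W x * s powr p \<partial>beta_measure b)"
        unfolding beta_avg_def
      proof (rule integral_mono[OF int])
        show "integrable (beta_measure b) (\<lambda>s. (1 + L * h) * W x * s powr p)"
          using p by (intro integrable_beta_measure continuous_intros) auto
        fix s assume "s \<in> space (beta_measure b)"
        then have s: "s \<in> {0<..<1}" by simp
        have "(x * s) powr p \<le> h"
          using powr_mono2[of p "x * s" d] xs[OF s] True p d by simp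
        moreover have "W (x * s) \<le> W x * s powr p"
        proof -
          have "exp (k * (x * s)) \<le> exp (k * x)" using xs[OF s] by (simp add: k_def mult_left_mono)
          then have "x powr p * s powr p * exp (k * (x * s)) \<le> x powr p * s powr p * exp (k * x)"
            by (intro mult_left_mono) auto
          then show ?thesis using x s by (simp add: W_def powr_mult mult_ac)
        qed
        ultimately have "(1 + L * (x * s) powr p) * W (x * s) \<le> (1 + L * h) * (W x * s powr p)"
          using L h by (intro mult_mono add_left_mono mult_left_mono) (auto simp: W_def)
        then show "(1 + L * (x * s) powr p) * W (x * s) \<le> (1 + L * h) * W x * s powr p"
          by (simp add: mult.assoc)
      qed
      also have "\<dots> = ((1 + L * h) * l) * W x" by (simp add: l_def beta_avg_def)
      also have "\<dots> \<le> q * W x" by (rule mult_right_mono[OF lh Wx])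
      finally show ?thesis .
    next
      case False
      have "beta_avg b (\<lambda>y. (1 + L * y powr p) * W y) x
          \<le> (\<integral>s. D * W x * exp (- (real n * d * (1 - s))) \<partial>beta_measure b)"
        unfolding beta_avg_def
      proof (rule integral_mono[OF int])
        show "integrable (beta_measure b) (\<lambda>s. D * W x * exp (- (real n * d * (1 - s))))"
          by (intro integrable_beta_measure continuous_intros)
        fix s assume "s \<in> space (beta_measure b)"
        then have s: "s \<in> {0<..<1}" by simp
        have "(x * s) powr p \<le> T powr p"
          using powr_mono2[of p "x * s" T] xs[OF s] x p by auto
        moreover have "W (x * s) \<le> W x * exp (- (real n * d * (1 - s)))"
        proof -
          \<comment> \<open>Replacing the rate \<open>x\<close> by the threshold \<open>d\<close>
            makes the decay uniform in all \<open>x > d\<close>, so that one \<open>n\<close> serves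
            them all.\<close>
          have "d * (1 - s) \<le> x * (1 - s)" using False s by (intro mult_right_mono) auto
          then have "k * (d * (1 - s)) \<le> k * (x * (1 - s))" by (simp add: k_def mult_left_mono)
          then have "exp (k * (x * s)) \<le> exp (k * x) * exp (- (real n * d * (1 - s)))"
            unfolding exp_add[symmetric] exp_le_cancel_iff by (simp add: k_def algebra_simps)
          moreover have "(x * s) powr p \<le> x powr p" using powr_mono2[of p "x * s" x] xs[OF s] p by simp
          ultimately show ?thesis
            unfolding W_def mult.assoc by (intro mult_mono) auto
        qed
        ultimately have "(1 + L * (x * s) powr p) * W (x * s) \<le> D * (W x * exp (- (real n * d * (1 - s))))"
          unfolding D_def using L by (intro mult_mono add_left_mono mult_left_mono) (auto simp: W_def)
        then show "(1 + L * (x * s) powr p) * W (x * s) \<le> D * W x * exp (- (real n * d * (1 - s)))"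
          by (simp add: mult.assoc)
      qed
      also have "\<dots> = W x * (D * (\<integral>s. exp (- (real n * d * (1 - s))) \<partial>beta_measure b))" by simp
      also have "\<dots> \<le> W x * (1 / 2)"
      proof (rule mult_left_mono[OF _ Wx])
        show "D * (\<integral>s. exp (- (real n * d * (1 - s))) \<partial>beta_measure b) \<le> 1 / 2"
          using mult_left_mono[OF less_imp_le[OF n], of D] D by (simp add: field_simps)
      qed
      also have "\<dots> \<le> q * W x" using mult_right_mono[OF q(3) Wx] by simp
      finally show ?thesis .
    qed
  qed
  show ?thesis
    by (rule that[of k q]) (use q bound in \<open>auto simp: k_def W_def\<close>)
qed

text \<open>Comparison of \<open>|d|\<close> with a multiple of \<open>x\<^sup>p\<close>, which has a spectral gap, via the maximum principle.
  Without it the supremum of \<open>|d| / (x\<^sup>p exp(kx))\<close> in the Gronwall argument could be infinite.\<close>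

lemma beta_avg_powr_decay:
  assumes d: "continuous_on {0..T} d" "d 0 = 0" and p: "0 < p" and A: "0 \<le> A"
    and le: "\<And>x. x \<in> {0<..T} \<Longrightarrow> \<bar>d x\<bar> \<le> beta_avg b (\<lambda>y. \<bar>d y\<bar> + A * y powr p) x"
  obtains A' where "0 \<le> A'" "\<And>x. x \<in> {0..T} \<Longrightarrow> \<bar>d x\<bar> \<le> A' * x powr p"
proof -
  define l where "l = beta_avg b (\<lambda>y. y powr p) 1"
  have l: "0 \<le> l" "l < 1" using beta_moment[OF p] by (simp_all add: l_def)
  \<comment> \<open>\<open>A'\<close> solves \<open>(A' + A) * l = A'\<close>: averaging
    \<open>(A' + A) * y powr p\<close> gives back \<open>A' * x powr p\<close>, so the forcing term
    disappears from the inequality for \<open>\<phi>\<close>.\<close>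
  define A' where "A' = A * l / (1 - l)"
  have A': "0 \<le> A'" "(A' + A) * l = A'" using l A by (simp_all add: A'_def field_simps)
  define \<phi> where "\<phi> x = \<bar>d x\<bar> - A' * x powr p" for x
  have c: "continuous_on {0..T} (\<lambda>y. c * y powr p)" for c
    using p by (intro continuous_intros) auto
  have \<phi>: "continuous_on {0..T} \<phi>"
    unfolding \<phi>_def using d p by (intro continuous_intros) auto
  have "\<phi> x \<le> 0" if x: "x \<in> {0..T}" for x
  proof (rule beta_avg_max_principle[OF \<phi> _ x])
    show "\<phi> 0 = 0" using d by (simp add: \<phi>_def)
    fix x assume x: "x \<in> {0<..T}"
    then have x': "x \<in> {0..T}" by auto
    have eq: "(\<lambda>y. \<bar>d y\<bar> + A * y powr p) = (\<lambda>y. \<phi> y + (A' + A) * y powr p)"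
      by (auto simp: \<phi>_def algebra_simps)
    have "\<phi> x \<le> beta_avg b (\<lambda>y. \<phi> y + (A' + A) * y powr p) x - A' * x powr p"
      using le[OF x] unfolding eq by (simp add: \<phi>_def)
    also have "\<dots> = beta_avg b \<phi> x + (A' + A) * (x powr p * l) - A' * x powr p"
      using x by (simp add: beta_avg_add[OF \<phi> c x'] beta_avg_mult_left beta_avg_powr[of x p] l_def)
    also have "\<dots> = beta_avg b \<phi> x + ((A' + A) * l) * x powr p - A' * x powr p"
      by (simp add: mult_ac)
    also have "\<dots> = beta_avg b \<phi> x" by (simp only: A'(2))
    finally show "\<phi> x \<le> beta_avg b \<phi> x" .
  qed
  then show ?thesis using A' by (intro that[of A']) (auto simp: \<phi>_def)
qed

text \<open>Let \<open>N\<close> be the best constant with \<open>|d| \<le> N * W\<close>. The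
  contraction gives \<open>N \<le> (N + e) * q\<close>, hence \<open>N \<le> e / (1 - q)\<close>,
  provided \<open>N\<close> is finite. The numbers \<open>k\<close> and \<open>q\<close> are
  parameters so that the bound uses the same constant for all \<open>d\<close> and
  \<open>e\<close>.\<close>

lemma beta_avg_Gronwall:
  assumes p: "0 < p" and L: "0 \<le> L" and T: "0 < T" and k: "0 \<le> k" and q: "0 \<le> q" "q < 1"
    and contr: "\<And>x. x \<in> {0..T} \<Longrightarrow> beta_avg b (\<lambda>y. (1 + L * y powr p) * (y powr p * exp (k * y))) x
       \<le> q * (x powr p * exp (k * x))"
    and d: "continuous_on {0..T} d" "d 0 = 0" and e: "0 \<le> e"
    and le: "\<And>x. x \<in> {0<..T} \<Longrightarrow>
       \<bar>d x\<bar> \<le> beta_avg b (\<lambda>y. (1 + L * y powr p) * \<bar>d y\<bar> + e * y powr p) x"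
    and x: "x \<in> {0..T}"
  shows "\<bar>d x\<bar> \<le> e / (1 - q) * (x powr p * exp (k * x))"
proof -
  define W where "W y = y powr p * exp (k * y)" for y
  note contr = contr[folded W_def]
  have Wpos: "0 < W x" if "0 < x" for x using that by (simp add: W_def)
  obtain D where D0: "0 \<le> D" and D: "\<And>y. y \<in> {0..T} \<Longrightarrow> \<bar>d y\<bar> \<le> D"
    using continuous_on_Icc_bounded[OF d(1)] by blast
  \<comment> \<open>The crude bound \<open>D\<close> of \<open>d\<close> turns the Lipschitz term
    into a multiple of \<open>y powr p\<close>; the decay lemma then makes the supremum
    \<open>N\<close> finite.\<close>
  have le': "\<bar>d x\<bar> \<le> beta_avg b (\<lambda>y. \<bar>d y\<bar> + (L * D + e) * y powr p) x" if x: "x \<in> {0<..T}" for x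
  proof -
    have "beta_avg b (\<lambda>y. (1 + L * y powr p) * \<bar>d y\<bar> + e * y powr p) x
        \<le> beta_avg b (\<lambda>y. \<bar>d y\<bar> + (L * D + e) * y powr p) x"
    proof (rule beta_avg_mono[of T])
      fix y assume y: "y \<in> {0..x}"
      have "L * y powr p * \<bar>d y\<bar> \<le> L * y powr p * D"
        using D[of y] y x L by (intro mult_left_mono) auto
      then show "(1 + L * y powr p) * \<bar>d y\<bar> + e * y powr p \<le> \<bar>d y\<bar> + (L * D + e) * y powr p"
        by (simp add: algebra_simps)
    qed (use x d p in \<open>auto intro!: continuous_intros\<close>)
    with le[OF x] show ?thesis by simp
  qed
  have "0 \<le> L * D + e" using L D0 e by simp
  then obtain A where A: "0 \<le> A" "\<And>x. x \<in> {0..T} \<Longrightarrow> \<bar>d x\<bar> \<le> A * x powr p"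
    using beta_avg_powr_decay[OF d p _ le'] by blast
  define N where "N = (SUP x\<in>{0<..T}. \<bar>d x\<bar> / W x)"
  have bdd: "bdd_above ((\<lambda>x. \<bar>d x\<bar> / W x) ` {0<..T})"
  proof (rule bdd_aboveI2)
    fix x assume x: "x \<in> {0<..T}"
    have "\<bar>d x\<bar> \<le> A * x powr p" using A x by simp
    also have "\<dots> \<le> A * W x" using A k x unfolding W_def by (intro mult_left_mono) auto
    finally show "\<bar>d x\<bar> / W x \<le> A" using Wpos[of x] x by (simp add: divide_le_eq)
  qed
  have N: "\<bar>d x\<bar> \<le> N * W x" if x: "x \<in> {0<..T}" for x
    using cSUP_upper[OF x bdd] Wpos[of x] x by (simp add: N_def divide_le_eq)
  have d0: "\<bar>d x\<bar> \<le> N * W x" if x: "x \<in> {0..T}" for x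
    using N[of x] that d by (cases "x = 0") (auto simp: W_def)
  have "\<bar>d x\<bar> / W x \<le> (N + e) * q" if x: "x \<in> {0<..T}" for x
  proof -
    have "\<bar>d x\<bar> \<le> beta_avg b (\<lambda>y. (1 + L * y powr p) * \<bar>d y\<bar> + e * y powr p) x" by (rule le[OF x])
    also have "\<dots> \<le> beta_avg b (\<lambda>y. (N + e) * ((1 + L * y powr p) * W y)) x"
    proof (rule beta_avg_mono[of T])
      fix y assume y: "y \<in> {0..x}"
      have "(1 + L * y powr p) * \<bar>d y\<bar> \<le> (1 + L * y powr p) * (N * W y)"
        using d0[of y] y x L by (intro mult_left_mono) auto
      \<comment> \<open>The forcing term is itself dominated by the weight, so it merely raises
        \<open>N\<close> to \<open>N + e\<close>.\<close>
      moreover have "y powr p \<le> W y" using k y mult_left_mono[of 1 "exp (k * y)" "y powr p"] unfolding W_def by simp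
      then have "1 * y powr p \<le> (1 + L * y powr p) * W y"
        using L by (intro mult_mono) auto
      then have "e * y powr p \<le> e * ((1 + L * y powr p) * W y)" using e by (intro mult_left_mono) auto
      ultimately show "(1 + L * y powr p) * \<bar>d y\<bar> + e * y powr p \<le> (N + e) * ((1 + L * y powr p) * W y)"
        by (simp add: algebra_simps)
    qed (use x d p in \<open>auto intro!: continuous_intros simp: W_def\<close>)
    also have "\<dots> = (N + e) * beta_avg b (\<lambda>y. (1 + L * y powr p) * W y) x" by (rule beta_avg_mult_left)
    also have "\<dots> \<le> (N + e) * (q * W x)"
    proof (rule mult_left_mono[OF contr])
      have "0 \<le> \<bar>d x\<bar> / W x" using Wpos[of x] x by simp
      also have "\<dots> \<le> N" using cSUP_upper[OF x bdd] by (simp add: N_def)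
      finally show "0 \<le> N + e" using e by simp
    qed (use x in auto)
    finally show ?thesis using Wpos[of x] x by (simp add: divide_le_eq mult_ac)
  qed
  then have "N \<le> (N + e) * q" unfolding N_def using T by (intro cSUP_least) auto
  moreover have "e * q \<le> e" using e q by (simp add: mult_left_le)
  ultimately have "N * (1 - q) \<le> e" by (simp add: algebra_simps)
  then have "N \<le> e / (1 - q)" using q by (simp add: le_divide_eq)
  then have "N * W x \<le> e / (1 - q) * W x" by (rule mult_right_mono) (simp add: W_def)
  with d0[OF x] show ?thesis by (simp add: W_def)
qed

lemma abs_beta_avg_diff_le:
  assumes "continuous_on {0..T} g" "continuous_on {0..T} h" "x \<in> {0..T}"
    and "\<And>y. y \<in> {0..T} \<Longrightarrow> \<bar>g y - h y\<bar> \<le> r y" and r: "continuous_on {0..T} r"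
  shows "\<bar>beta_avg b g x - beta_avg b h x\<bar> \<le> beta_avg b r x"
proof -
  have "\<bar>beta_avg b g x - beta_avg b h x\<bar> = \<bar>beta_avg b (\<lambda>y. g y - h y) x\<bar>"
    using assms by (simp add: beta_avg_diff[of T])
  also have "\<dots> \<le> beta_avg b (\<lambda>y. \<bar>g y - h y\<bar>) x"
    by (rule abs_beta_avg_le)
  also have "\<dots> \<le> beta_avg b r x"
    using assms by (intro beta_avg_mono[of T] continuous_intros) auto
  finally show ?thesis .
qed

text \<open>Picard iteration from the constant \<open>u0\<close>. Averaging fixes this constant, so
  the first increment is only the average of \<open>G\<close>, which is of order \<open>W\<close>;
  later increments shrink by \<open>q\<close> and the series converges uniformly. The equation alone
  does not determine \<open>u 0\<close>: the initial value is inherited from the iterates.\<close>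

lemma beta_avg_fixed_point:
  fixes G :: "real \<Rightarrow> real \<Rightarrow> real"
  assumes p: "0 < p" and L: "0 \<le> L" and T: "0 < T"
    and cont: "\<And>w. continuous_on {0..T} w \<Longrightarrow> continuous_on {0..T} (\<lambda>y. G y (w y))"
    and bound: "\<And>y z. y \<in> {0..T} \<Longrightarrow> \<bar>G y z\<bar> \<le> A * y powr p"
    and lip: "\<And>y z z'. y \<in> {0..T} \<Longrightarrow> \<bar>G y z - G y z'\<bar> \<le> L * y powr p * \<bar>z - z'\<bar>"
  obtains u where "continuous_on {0..T} u" "u 0 = u0"
    "\<And>x. x \<in> {0..T} \<Longrightarrow> u x = beta_avg b (\<lambda>y. u y + G y (u y)) x"
proof -
  obtain k q where kq: "0 \<le> k" "0 \<le> q" "q < 1"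
    and contr: "\<And>x. x \<in> {0..T} \<Longrightarrow> beta_avg b (\<lambda>y. (1 + L * y powr p) * (y powr p * exp (k * y))) x
       \<le> q * (x powr p * exp (k * x))"
    using beta_avg_contraction[OF p L T] by blast
  define W where "W y = y powr p * exp (k * y)" for y
  note contr = contr[folded W_def]
  have "0 \<le> A * T powr p" using bound[of T 0] T by simp
  then have A: "0 \<le> A" using T by (simp add: zero_le_mult_iff)
  have Wc: "continuous_on {0..T} W" unfolding W_def using p by (intro continuous_intros) auto
  define P where "P w y = w y + G y (w y)" for w :: "real \<Rightarrow> real" and y
  have Pc: "continuous_on {0..T} (P w)" if "continuous_on {0..T} w" for w
    unfolding P_def using that by (intro continuous_intros cont)
  have Pd: "\<bar>P w y - P w' y\<bar> \<le> (1 + L * y powr p) * \<bar>w y - w' y\<bar>" if "y \<in> {0..T}" for w w' y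
    using lip[OF that, of "w y" "w' y"] unfolding P_def by (simp add: algebra_simps)
  define U where "U n = ((\<lambda>w. beta_avg b (P w)) ^^ n) (\<lambda>_. u0)" for n
  have U0: "U 0 = (\<lambda>_. u0)" and US: "U (Suc n) = beta_avg b (P (U n))" for n
    by (simp_all add: U_def)
  have Uc: "continuous_on {0..T} (U n)" for n
    by (induction n) (auto simp: U0 US intro!: continuous_on_beta_avg Pc)
  have step: "\<bar>U (Suc n) x - U n x\<bar> \<le> A * q ^ n * W x" if "x \<in> {0..T}" for n x
    using that
  proof (induction n arbitrary: x)
    case 0
    have "\<bar>beta_avg b (P (\<lambda>_. u0)) x - beta_avg b (\<lambda>_. u0) x\<bar> \<le> beta_avg b (\<lambda>y. A * ((1 + L * y powr p) * W y)) x"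
    proof (rule abs_beta_avg_diff_le[of T])
      fix y assume y: "y \<in> {0..T}"
      have "y powr p \<le> W y" using kq y mult_left_mono[of 1 "exp (k * y)" "y powr p"] unfolding W_def by simp
      then have "1 * y powr p \<le> (1 + L * y powr p) * W y" using L by (intro mult_mono) auto
      then have "A * y powr p \<le> A * ((1 + L * y powr p) * W y)" using A by (intro mult_left_mono) auto
      with bound[OF y, of u0] show "\<bar>P (\<lambda>_. u0) y - u0\<bar> \<le> A * ((1 + L * y powr p) * W y)"
        by (simp add: P_def)
    qed (use 0 p in \<open>auto intro!: Pc Wc continuous_intros\<close>)
    also have "\<dots> \<le> A * (q * W x)"
      unfolding beta_avg_mult_left by (rule mult_left_mono[OF contr[OF 0] A])
    also have "\<dots> \<le> A * W x"
      using A kq by (intro mult_left_mono) (auto simp: W_def mult_left_le_one_le)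
    finally show ?case by (simp add: U0 US)
  next
    case (Suc n)
    have "\<bar>beta_avg b (P (U (Suc n))) x - beta_avg b (P (U n)) x\<bar>
        \<le> beta_avg b (\<lambda>y. (A * q ^ n) * ((1 + L * y powr p) * W y)) x"
    proof (rule abs_beta_avg_diff_le[of T])
      fix y assume y: "y \<in> {0..T}"
      have "(1 + L * y powr p) * \<bar>U (Suc n) y - U n y\<bar> \<le> (1 + L * y powr p) * (A * q ^ n * W y)"
        using L by (intro mult_left_mono[OF Suc.IH[OF y]]) auto
      with Pd[OF y, of "U (Suc n)" "U n"]
      show "\<bar>P (U (Suc n)) y - P (U n) y\<bar> \<le> (A * q ^ n) * ((1 + L * y powr p) * W y)"
        by (simp add: algebra_simps)
    qed (use Suc.prems p in \<open>auto intro!: Pc Uc Wc continuous_intros\<close>)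
    also have "\<dots> \<le> A * q ^ n * (q * W x)"
      unfolding beta_avg_mult_left
      by (rule mult_left_mono[OF contr[OF Suc.prems]]) (use A kq in auto)
    finally show ?case by (simp add: US mult_ac)
  qed
  define S where "S x = (\<Sum>i. U (Suc i) x - U i x)" for x
  have "uniform_limit {0..T} (\<lambda>n x. \<Sum>i<n. U (Suc i) x - U i x) S sequentially"
    unfolding S_def
  proof (rule Weierstrass_m_test)
    fix n x assume x: "x \<in> {0..T}"
    have "W x \<le> W T" using x p kq unfolding W_def
      by (intro mult_mono powr_mono2) (auto simp: mult_left_mono)
    then have "A * q ^ n * W x \<le> A * q ^ n * W T" using A kq by (intro mult_left_mono) auto
    with step[OF x, of n] show "norm (U (Suc n) x - U n x) \<le> (A * W T) * q ^ n"
      by (simp add: mult_ac)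
  next
    show "summable (\<lambda>n. (A * W T) * q ^ n)"
      using kq by (intro summable_mult summable_geometric) auto
  qed
  moreover have "(\<Sum>i<n. U (Suc i) x - U i x) = U n x - u0" for n x
    using sum_lessThan_telescope[of "\<lambda>i. U i x" n] by (simp add: U0)
  ultimately have ul: "uniform_limit {0..T} (\<lambda>n x. U n x - u0) S sequentially" by simp
  define u where "u x = u0 + S x" for x
  have Sc: "continuous_on {0..T} S"
    by (rule uniform_limit_theorem[OF _ ul]) (auto intro!: always_eventually continuous_intros Uc)
  then have uc: "continuous_on {0..T} u" unfolding u_def by (intro continuous_intros)
  have near: "\<forall>\<^sub>F n in sequentially. \<forall>x\<in>{0..T}. \<bar>U n x - u x\<bar> < e" if "0 < e" for e
    using uniform_limitD[OF ul that] by (simp add: dist_real_def u_def algebra_simps)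
  have fix_u: "u x = beta_avg b (P u) x" if x: "x \<in> {0..T}" for x
  proof -
    have "\<bar>u x - beta_avg b (P u) x\<bar> \<le> e" if e: "0 < e" for e
    proof -
      \<comment> \<open>\<open>D\<close> is a Lipschitz constant of \<open>P\<close> in the sup
        norm, so closeness \<open>e'\<close> of the iterates costs at most \<open>e / 2\<close>
        after averaging.\<close>
      define D where "D = 1 + L * T powr p"
      have D: "1 \<le> D" using L by (simp add: D_def)
      define e' where "e' = e / (2 * D)"
      have e': "0 < e'" "D * e' = e / 2" "e' \<le> e / 2" using e D by (simp_all add: e'_def field_simps)
      obtain n where n: "\<And>m y. n \<le> m \<Longrightarrow> y \<in> {0..T} \<Longrightarrow> \<bar>U m y - u y\<bar> < e'"
        using near[OF e'(1)] unfolding eventually_sequentially by blast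
      have "\<bar>beta_avg b (P (U n)) x - beta_avg b (P u) x\<bar> \<le> beta_avg b (\<lambda>_. D * e') x"
      proof (rule abs_beta_avg_diff_le[of T])
        fix y assume y: "y \<in> {0..T}"
        have "y powr p \<le> T powr p" using y p by (intro powr_mono2) auto
        then have "(1 + L * y powr p) * \<bar>U n y - u y\<bar> \<le> D * e'"
          unfolding D_def using n[OF order_refl y] L by (intro mult_mono add_left_mono mult_left_mono) auto
        with Pd[OF y, of "U n" u] show "\<bar>P (U n) y - P u y\<bar> \<le> D * e'" by simp
      qed (use x in \<open>auto intro!: Pc Uc uc\<close>)
      then have "\<bar>U (Suc n) x - beta_avg b (P u) x\<bar> \<le> e / 2" by (simp add: US e')
      moreover have "\<bar>U (Suc n) x - u x\<bar> \<le> e / 2" using n[of "Suc n" x] x e'(3) by simp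
      ultimately show ?thesis by linarith
    qed
    then have "\<bar>u x - beta_avg b (P u) x\<bar> \<le> 0" by (rule field_le_epsilon[of _ 0, simplified])
    then show ?thesis by simp
  qed
  \<comment> \<open>At 0 the average is the value itself, and \<open>bound\<close> forces
    \<open>G 0 z = 0\<close> because \<open>0 powr p = 0\<close>.\<close>
  have "U n 0 = u0" for n
    using bound[of 0] T p by (induction n) (auto simp: U0 US P_def)
  then have "S 0 = 0" by (simp add: S_def)
  then have "u 0 = u0" by (simp add: u_def)
  with uc show ?thesis using fix_u[unfolded P_def[abs_def]] by (rule that)
qed

end

section \<open>Equivalence with the averaged equation\<close>

text \<open>A rescaling of the integrand of \<open>Beta (1 - b) 1\<close>, whose second factor has
  exponent 0 and equals 1 inside the interval.\<close>

lemma set_integrable_powr_neg: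
  fixes b x :: real
  assumes "b < 1"
  shows "set_integrable lborel {0<..<x} (\<lambda>r. r powr (-b))"
proof (cases "0 < x")
  case True
  have "integrable lborel (\<lambda>t. x powr (-b) * (indicator {0<..<1} t * (t powr (1 - b - 1) * (1 - t) powr (1 - 1))))"
    using has_bochner_integral_Beta[of "1 - b" 1] assms
    by (intro integrable_mult_right) (simp add: has_bochner_integral_iff)
  also have "(\<lambda>t. x powr (-b) * (indicator {0<..<1} t * (t powr (1 - b - 1) * (1 - t) powr (1 - 1))))
      = (\<lambda>t. indicator {0<..<x} (0 + x * t) *\<^sub>R (0 + x * t) powr (-b))"
    using True by (auto simp: indicator_def powr_mult zero_less_mult_iff)
  finally show ?thesis
    using lborel_integrable_real_affine_iff[of x "\<lambda>r. indicator {0<..<x} r *\<^sub>R r powr (-b)" 0] True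
    unfolding set_integrable_def by blast
qed (simp add: set_integrable_def)

lemma set_integrable_bound_Ioo:
  fixes f g :: "real \<Rightarrow> real"
  assumes g: "set_integrable lborel {0<..<x} g" and f: "continuous_on {0<..<x} f"
    and le: "\<And>r. r \<in> {0<..<x} \<Longrightarrow> \<bar>f r\<bar> \<le> \<bar>g r\<bar>"
  shows "set_integrable lborel {0<..<x} f"
  unfolding set_integrable_def
proof (rule Bochner_Integration.integrable_bound)
  show "integrable lborel (\<lambda>r. indicator {0<..<x} r *\<^sub>R g r)"
    using g by (simp add: set_integrable_def)
  show "(\<lambda>r. indicator {0<..<x} r *\<^sub>R f r) \<in> borel_measurable lborel"
    using borel_measurable_continuous_on_indicator[OF _ f] by simp
  show "AE r in lborel. norm (indicator {0<..<x} r *\<^sub>R f r) \<le> norm (indicator {0<..<x} r *\<^sub>R g r)"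
    using le by (intro AE_I2) (simp add: indicator_def)
qed

section \<open>One-sided calculus on half-open intervals\<close>

lemma has_real_derivative_transform_on:
  fixes f g :: "real \<Rightarrow> real"
  assumes "x \<in> S" "\<And>y. y \<in> S \<Longrightarrow> g y = f y" "(f has_real_derivative D) (at x within S)"
  shows "(g has_real_derivative D) (at x within S)"
  using has_vector_derivative_transform[OF assms(1,2)] assms(3)
  by (simp add: has_real_derivative_iff_has_vector_derivative)

text \<open>The integrand may blow up at 0. The form of the fundamental theorem used here asks for
  integrability on \<open>{0..T}\<close> and continuity at \<open>x\<close> away from the
  exceptional set \<open>{0}\<close>.\<close>

lemma has_real_derivative_set_integral:
  fixes f :: "real \<Rightarrow> real"
  assumes f: "continuous_on {0<..T} f" and int: "set_integrable lborel {0<..<T} f"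
    and x: "x \<in> {0<..T}"
  shows "((\<lambda>y. LBINT r:{0<..<y}. f r) has_real_derivative f x) (at x within {0<..T})"
proof -
  have "f integrable_on {0<..<T}" by (rule set_borel_integral_eq_integral(1)[OF int])
  then have fT: "f integrable_on {0..T}" by (simp add: integrable_on_Icc_iff_Ioo)
  have T: "{0..T} - {0} = {0<..T}" by auto
  have "((\<lambda>y. integral {0..y} f) has_vector_derivative f x) (at x within ({0..T} - {0}))"
    using f x by (intro integral_has_vector_derivative_continuous_at[OF fT])
      (auto simp: T continuous_on_eq_continuous_within)
  then have D: "((\<lambda>y. integral {0..y} f) has_real_derivative f x) (at x within {0<..T})"
    by (simp add: T has_real_derivative_iff_has_vector_derivative)
  show ?thesis
  proof (rule has_real_derivative_transform_on[OF x _ D])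
    fix y assume "y \<in> {0<..T}"
    then have "set_integrable lborel {0<..<y} f" by (intro set_integrable_subset[OF int]) auto
    from set_borel_integral_eq_integral(2)[OF this]
    show "(LBINT r:{0<..<y}. f r) = integral {0..y} f"
      by (simp add: integral_open_interval_real)
  qed
qed

text \<open>Points accumulate from the left at each \<open>x\<close>, even at \<open>x = T\<close>;
  this makes one-sided derivatives unique.\<close>

lemma at_within_Ioc_neq_bot:
  fixes x :: real
  assumes "x \<in> {0<..T}"
  shows "at x within {0<..T} \<noteq> bot"
proof -
  have "at x within {0<..<x} \<le> at x within {0<..T}" using assms by (intro at_le) auto
  moreover have "at x within {0<..<x} \<noteq> bot"
    using assms at_within_eq_bot_iff[of x "{0<..<x}"] closure_greaterThanLessThan[of 0 x] by simp
  ultimately show ?thesis by (metis bot.extremum_uniqueI)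
qed

lemma J0_cong:
  assumes "\<And>r. r \<in> {0<..<x} \<Longrightarrow> u r = v r"
  shows "J0 b u x = J0 b v x"
  unfolding J0_def by (rule set_lebesgue_integral_cong) (use assms in auto)

context fractional_order
begin

text \<open>By scaling, \<open>J0 b u x\<close> is bounded by a multiple of
  \<open>x powr (1 - b)\<close>, whose exponent is positive. This limit later fixes a constant of
  integration.\<close>

lemma J0_tendsto_0:
  assumes T: "0 < T" and u: "continuous_on {0..T} u"
  shows "(J0 b u \<longlongrightarrow> 0) (at 0 within {0<..T})"
proof -
  obtain C where C: "0 \<le> C" "\<And>x. x \<in> {0..T} \<Longrightarrow> \<bar>u x\<bar> \<le> C"
    using continuous_on_Icc_bounded[OF u] by blast
  define I where "I = (LBINT s:{0<..<1}. (1 - s) powr (-b) * C)"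
  have intC: "set_integrable lborel {0<..<1} (\<lambda>s. (1 - s) powr (-b) * C)"
  proof -
    have "integrable lborel (\<lambda>t. indicator {0<..<1} t * (t powr (1 - 1) * (1 - t) powr (1 - b - 1)))"
      using has_bochner_integral_Beta[of 1 "1 - b"] b by (simp add: has_bochner_integral_iff)
    also have "(\<lambda>t::real. indicator {0<..<1} t * (t powr (1 - 1) * (1 - t) powr (1 - b - 1)))
        = (\<lambda>t. indicator {0<..<1} t *\<^sub>R (1 - t) powr (-b))"
      by (auto simp: indicator_def)
    finally show ?thesis by (intro set_integrable_mult_left) (simp add: set_integrable_def)
  qed
  have le: "\<bar>J0 b u x\<bar> \<le> x powr (1 - b) / Gamma (1 - b) * I" if x: "x \<in> {0<..T}" for x
  proof -
    have "\<bar>LBINT s:{0<..<1}. (1 - s) powr (-b) * u (x * s)\<bar> \<le> I"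
      unfolding I_def set_lebesgue_integral_def real_norm_def[symmetric]
    proof (rule Bochner_Integration.integral_norm_bound_integral)
      have ab: "\<bar>(1 - s) powr (-b) * u (x * s)\<bar> \<le> \<bar>(1 - s) powr (-b) * C\<bar>" if "s \<in> {0<..<1}" for s
        using that C scaled_mem_Icc[of x T s] x
        by (auto simp: abs_mult intro!: mult_left_mono)
      have "continuous_on {0<..<1} (\<lambda>s. (1 - s) powr (-b) * u (x * s))"
        using x by (intro continuous_intros continuous_on_subset[OF continuous_on_scaled[OF u]]) auto
      from set_integrable_bound_Ioo[OF intC this ab]
      show "integrable lborel (\<lambda>s. indicator {0<..<1} s *\<^sub>R ((1 - s) powr - b * u (x * s)))"
        by (simp add: set_integrable_def)
      show "integrable lborel (\<lambda>s. indicator {0<..<1} s *\<^sub>R ((1 - s) powr - b * C))"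
        using intC by (simp add: set_integrable_def)
      show "norm (indicator {0<..<1} s *\<^sub>R ((1 - s) powr - b * u (x * s)))
          \<le> indicator {0<..<1} s *\<^sub>R ((1 - s) powr - b * C)" for s
        using ab[of s] C(1) by (cases "s \<in> {0<..<1}") auto
    qed
    then have "x powr (1 - b) / Gamma (1 - b) * \<bar>LBINT s:{0<..<1}. (1 - s) powr (-b) * u (x * s)\<bar>
        \<le> x powr (1 - b) / Gamma (1 - b) * I"
      using b by (intro mult_left_mono) (auto intro!: divide_nonneg_pos Gamma_real_pos)
    moreover have "\<bar>x powr (1 - b) / Gamma (1 - b)\<bar> = x powr (1 - b) / Gamma (1 - b)"
      using b Gamma_real_pos[of "1 - b"] by (simp add: abs_divide)
    ultimately show ?thesis using x by (simp only: J0_scale[of x b u] abs_mult greaterThanAtMost_iff)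
  qed
  have "continuous_on {0..T} (\<lambda>x. x powr (1 - b) / Gamma (1 - b) * I)"
    using b Gamma_order_nonzero by (intro continuous_intros) auto
  then have "((\<lambda>x. x powr (1 - b) / Gamma (1 - b) * I) \<longlongrightarrow> 0) (at 0 within {0..T})"
    using T b unfolding continuous_on_def by (auto dest!: bspec[of _ _ 0])
  then have lim: "((\<lambda>x. x powr (1 - b) / Gamma (1 - b) * I) \<longlongrightarrow> 0) (at 0 within {0<..T})"
    by (rule tendsto_within_subset) auto
  have "\<forall>\<^sub>F x in at 0 within {0<..T}. norm (J0 b u x) \<le> x powr (1 - b) / Gamma (1 - b) * I"
    unfolding eventually_at_filter real_norm_def using le by (intro always_eventually) blast
  then show ?thesis by (rule Lim_null_comparison[OF _ lim])
qed

section \<open>Averages as fractional integrals of a singular source\<close>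

lemma continuous_on_singular_source:
  assumes "continuous_on {0..T} p"
  shows "continuous_on {0<..T} (\<lambda>r. r powr (-b) / Gamma (1 - b) * p r)"
  using Gamma_order_nonzero
  by (intro continuous_intros continuous_on_subset[OF assms]) auto

lemma set_integrable_singular_source:
  assumes p: "continuous_on {0..T} p"
  shows "set_integrable lborel {0<..<T} (\<lambda>r. r powr (-b) / Gamma (1 - b) * p r)"
proof -
  obtain C where C: "0 \<le> C" "\<And>x. x \<in> {0..T} \<Longrightarrow> \<bar>p x\<bar> \<le> C"
    using continuous_on_Icc_bounded[OF p] by blast
  have "set_integrable lborel {0<..<T} (\<lambda>r. C / Gamma (1 - b) * r powr (-b))"
    using set_integrable_powr_neg[of b T] b by (intro set_integrable_mult_right) auto
  then show ?thesis
  proof (rule set_integrable_bound_Ioo)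
    show "continuous_on {0<..<T} (\<lambda>r. r powr (-b) / Gamma (1 - b) * p r)"
      by (rule continuous_on_subset[OF continuous_on_singular_source[OF p]]) auto
    fix r assume "r \<in> {0<..<T}"
    then have "\<bar>r powr (-b) / Gamma (1 - b)\<bar> * \<bar>p r\<bar> \<le> \<bar>r powr (-b) / Gamma (1 - b)\<bar> * C"
      using C by (intro mult_left_mono) auto
    then show "\<bar>r powr (-b) / Gamma (1 - b) * p r\<bar> \<le> \<bar>C / Gamma (1 - b) * r powr (-b)\<bar>"
      using C by (simp add: abs_mult mult_ac)
  qed
qed

text \<open>After rescaling, \<open>x powr b\<close> cancels against \<open>x powr (-b)\<close> and
  the remaining factors form the beta density. This is the bridge between averages and fractional
  integrals.\<close>

lemma beta_avg_eq_J0: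
  assumes p: "continuous_on {0..T} p" and x: "x \<in> {0<..T}"
  shows "beta_avg b p x = J0 (1 - b) (\<lambda>r. r powr (-b) / Gamma (1 - b) * p r) x"
proof -
  have "beta_avg b p x = (LBINT s:{0<..<1}. beta_density b s * p (x * s))"
    unfolding beta_avg_def using x
    by (intro integral_beta_measure continuous_on_subset[OF continuous_on_scaled[OF p]]) auto
  also have "\<dots> = (LBINT s:{0<..<1}. x powr b / Gamma b *
      ((1 - s) powr (-(1 - b)) * ((x * s) powr (-b) / Gamma (1 - b) * p (x * s))))"
  proof (rule set_lebesgue_integral_cong)
    have "x powr b * x powr (-b) = 1" using x by (simp add: powr_minus)
    then have "x powr b / Gamma b * ((1 - s) powr (-(1 - b)) * ((x * s) powr (-b) / Gamma (1 - b) * p (x * s)))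
        = beta_density b s * p (x * s)" if "s \<in> {0<..<1}" for s
      using x that by (simp add: powr_mult beta_density_def mult_ac)
    then show "\<forall>s. s \<in> {0<..<1} \<longrightarrow> beta_density b s * p (x * s) = x powr b / Gamma b *
      ((1 - s) powr (-(1 - b)) * ((x * s) powr (-b) / Gamma (1 - b) * p (x * s)))" by metis
  qed simp
  also have "\<dots> = J0 (1 - b) (\<lambda>r. r powr (-b) / Gamma (1 - b) * p r) x"
    using x by (subst J0_scale) auto
  finally show ?thesis .
qed

text \<open>Abel's composition collapses two fractional integrals into an ordinary one, so the
  left-hand side can be differentiated although \<open>beta_avg b p\<close> is only known to be
  continuous.\<close>

lemma J0_beta_avg:
  assumes p: "continuous_on {0..T} p" and x: "x \<in> {0<..T}"
  shows "J0 b (beta_avg b p) x = (LBINT r:{0<..<x}. r powr (-b) / Gamma (1 - b) * p r)"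
proof -
  have "J0 b (beta_avg b p) x = J0 b (J0 (1 - b) (\<lambda>r. r powr (-b) / Gamma (1 - b) * p r)) x"
    using x by (intro J0_cong beta_avg_eq_J0[OF p]) auto
  also have "\<dots> = (LBINT r:{0<..<x}. r powr (-b) / Gamma (1 - b) * p r)"
    using b x by (intro J0_J0 set_integrable_subset[OF set_integrable_singular_source[OF p]]) auto
  finally show ?thesis .
qed

lemma has_real_derivative_J0_beta_avg:
  assumes p: "continuous_on {0..T} p" and x: "x \<in> {0<..T}"
  shows "(J0 b (beta_avg b p) has_real_derivative x powr (-b) / Gamma (1 - b) * p x) (at x within {0<..T})"
  by (rule has_real_derivative_transform_on[OF x J0_beta_avg[OF p]
        has_real_derivative_set_integral[OF continuous_on_singular_source[OF p]
          set_integrable_singular_source[OF p] x]])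

section \<open>Passage between fixed points and solutions\<close>

lemma censored_deriv_eqI:
  assumes "(J0 b u has_real_derivative D) (at x within {0<..T})" "x \<in> {0<..T}"
  shows "censored_deriv b T u x = D - x powr (-b) / Gamma (1 - b) * u x"
  using assms vector_derivative_within[OF at_within_Ioc_neq_bot[OF assms(2)]]
  by (simp add: censored_deriv_def has_real_derivative_iff_has_vector_derivative)

text \<open>In applications \<open>p\<close> is \<open>u\<close> plus the source. Differentiating
  \<open>J0 b u\<close> yields the term with \<open>p\<close>, and the censoring term subtracts
  \<open>u\<close> from it, leaving the source.\<close>

lemma C_beta_solution_of_fixed_point:
  assumes p: "continuous_on {0..T} p" and u: "continuous_on {0..T} u"
    and fp: "\<And>x. x \<in> {0..T} \<Longrightarrow> u x = beta_avg b p x"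
  shows "u \<in> C_beta b T"
    and "x \<in> {0<..T} \<Longrightarrow> censored_deriv b T u x = x powr (-b) / Gamma (1 - b) * (p x - u x)"
proof -
  have D: "(J0 b u has_real_derivative x powr (-b) / Gamma (1 - b) * p x) (at x within {0<..T})"
    if "x \<in> {0<..T}" for x
    by (rule has_real_derivative_transform_on[OF that _ has_real_derivative_J0_beta_avg[OF p that]])
       (auto intro!: J0_cong fp)
  then have "J0 b u \<in> C1_left_open T"
    unfolding C1_left_open_def using continuous_on_singular_source[OF p] by blast
  moreover have "u \<in> C_L1 T"
    unfolding C_L1_def
    by (auto intro!: continuous_on_subset[OF u] set_integrable_subset[OF borel_integrable_atLeastAtMost'[OF u]])
  ultimately show "u \<in> C_beta b T" using u by (simp add: C_beta_def C_beta_left_open_def)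
  show "censored_deriv b T u x = x powr (-b) / Gamma (1 - b) * (p x - u x)" if "x \<in> {0<..T}"
    using censored_deriv_eqI[OF D[OF that] that] unfolding right_diff_distrib .
qed

text \<open>Applying \<open>J0 (1 - b)\<close> to both sides leaves ordinary integrals of
  \<open>u\<close> and \<open>v\<close>, which can be differentiated.\<close>

lemma J0_inj:
  assumes T: "0 < T" and u: "continuous_on {0..T} u" and v: "continuous_on {0..T} v"
    and eq: "\<And>x. x \<in> {0<..T} \<Longrightarrow> J0 b u x = J0 b v x" and x: "x \<in> {0<..T}"
  shows "u x = v x"
proof -
  have int: "set_integrable lborel {0<..<y} w" if "continuous_on {0..T} w" "y \<in> {0<..T}" for w :: "real \<Rightarrow> real" and y
    using that by (intro set_integrable_subset[OF borel_integrable_atLeastAtMost'[OF that(1)]]) auto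
  have inv: "J0 (1 - b) (J0 b w) y = (LBINT r:{0<..<y}. w r)" if "continuous_on {0..T} w" "y \<in> {0<..T}" for w y
    using J0_J0[of "1 - b" y w] int[OF that] b by simp
  have eq': "(LBINT r:{0<..<y}. u r) = (LBINT r:{0<..<y}. v r)" if y: "y \<in> {0<..T}" for y
    unfolding inv[OF u y, symmetric] inv[OF v y, symmetric] using y by (intro J0_cong eq) auto
  have D: "((\<lambda>y. LBINT r:{0<..<y}. w r) has_real_derivative w x) (at x within {0<..T})"
    if w: "continuous_on {0..T} w" for w
    using T by (intro has_real_derivative_set_integral int x continuous_on_subset[OF w] w) auto
  have "((\<lambda>y. LBINT r:{0<..<y}. u r) has_real_derivative v x) (at x within {0<..T})"
    by (rule has_real_derivative_transform_on[OF x eq' D[OF v]])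
  with D[OF u] show ?thesis
    unfolding has_real_derivative_iff_has_vector_derivative
    by (rule vector_derivative_unique_within[OF at_within_Ioc_neq_bot[OF x]])
qed

text \<open>\<open>J0 b u\<close> and \<open>J0 b (beta_avg b p)\<close> have the same derivative,
  hence differ by a constant. Both tend to 0 at 0, so the constant is 0 and injectivity of
  \<open>J0 b\<close> applies.\<close>

lemma fixed_point_of_C_beta_solution:
  assumes T: "0 < T" and p: "continuous_on {0..T} p" and u: "u \<in> C_beta b T"
    and sol: "\<And>x. x \<in> {0<..T} \<Longrightarrow> censored_deriv b T u x = x powr (-b) / Gamma (1 - b) * (p x - u x)"
    and x: "x \<in> {0<..T}"
  shows "u x = beta_avg b p x"
proof -
  have uc: "continuous_on {0..T} u" using u by (simp add: C_beta_def)
  have Kc: "continuous_on {0..T} (beta_avg b p)" by (rule continuous_on_beta_avg[OF p])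
  obtain F where F: "\<And>x. x \<in> {0<..T} \<Longrightarrow> (J0 b u has_real_derivative F x) (at x within {0<..T})"
    using u unfolding C_beta_def C_beta_left_open_def C1_left_open_def by blast
  have F': "F x = x powr (-b) / Gamma (1 - b) * p x" if "x \<in> {0<..T}" for x
  proof -
    have "F x - x powr (-b) / Gamma (1 - b) * u x = x powr (-b) / Gamma (1 - b) * (p x - u x)"
      using censored_deriv_eqI[OF F[OF that] that] sol[OF that] by simp
    then show ?thesis unfolding right_diff_distrib by linarith
  qed
  define E where "E x = J0 b u x - J0 b (beta_avg b p) x" for x
  have "(E has_real_derivative 0) (at x within {0<..T})" if "x \<in> {0<..T}" for x
    unfolding E_def
    using DERIV_diff[OF F[OF that] has_real_derivative_J0_beta_avg[OF p that]] F'[OF that] by simp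
  then obtain c where c: "\<And>x. x \<in> {0<..T} \<Longrightarrow> E x = c"
    using has_field_derivative_zero_constant[of "{0<..T}" E] by auto
  have "(E \<longlongrightarrow> 0) (at 0 within {0<..T})"
    unfolding E_def using tendsto_diff[OF J0_tendsto_0[OF T uc] J0_tendsto_0[OF T Kc]] by simp
  moreover have "(E \<longlongrightarrow> c) (at 0 within {0<..T})"
    by (rule tendsto_eventually) (auto simp: eventually_at_filter c)
  moreover have "at 0 within {0<..T} \<noteq> bot"
    using T at_within_eq_bot_iff[of 0 "{0<..T}"] closure_greaterThanAtMost[of 0 T] by simp
  ultimately have "c = 0" using tendsto_unique by blast
  with c have "J0 b u x = J0 b (beta_avg b p) x" if "x \<in> {0<..T}" for x
    using that by (simp add: E_def)
  from J0_inj[OF T uc Kc this x] show ?thesis by simp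
qed

end

section \<open>Existence, uniqueness and stability\<close>

text \<open>At 0 the bound gives both \<open>g 0 = 0\<close> and the limit 0; elsewhere the endpoint
  0 does not affect the neighbourhood filter.\<close>

lemma continuous_on_Icc_of_powr_bound:
  fixes g :: "real \<Rightarrow> real"
  assumes g: "continuous_on {0<..T} g" and p: "0 < p"
    and le: "\<And>y. y \<in> {0..T} \<Longrightarrow> \<bar>g y\<bar> \<le> C * y powr p"
  shows "continuous_on {0..T} g"
  unfolding continuous_on_def
proof
  fix x assume x: "x \<in> {0..T}"
  show "(g \<longlongrightarrow> g x) (at x within {0..T})"
  proof (cases "x = 0")
    case True
    have "continuous_on {0..T} (\<lambda>y. C * y powr p)"
      using p by (intro continuous_intros) auto
    then have "((\<lambda>y. C * y powr p) \<longlongrightarrow> C * 0 powr p) (at 0 within {0..T})"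
      using x True unfolding continuous_on_def by blast
    then have lim: "((\<lambda>y. C * y powr p) \<longlongrightarrow> 0) (at 0 within {0..T})" by simp
    have "\<forall>\<^sub>F y in at 0 within {0..T}. norm (g y) \<le> C * y powr p"
      unfolding eventually_at_filter real_norm_def using le by (intro always_eventually) blast
    then have "(g \<longlongrightarrow> 0) (at 0 within {0..T})" by (rule Lim_null_comparison[OF _ lim])
    moreover have "g 0 = 0" using le[of 0] x True by simp
    ultimately show ?thesis using True by simp
  next
    case False
    with x have "x \<in> {0<..T}" by simp
    moreover have "at x within {0..T} = at x within {0<..T}"
      by (rule at_within_nhd[of x "{0<..}"]) (use False x in auto)
    ultimately show ?thesis using g unfolding continuous_on_def by simp
  qed
qed

lemma continuous_on_lipschitz_compose:
  assumes cont: "\<And>y. y \<in> {u0 - Y..u0 + Y} \<Longrightarrow> continuous_on {0<..T} (\<lambda>x. f x y)"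
    and lip: "lipschitz_cond \<alpha> \<beta> L T u0 Y f"
    and w: "continuous_on {0<..T} w" "\<And>x. x \<in> {0<..T} \<Longrightarrow> w x \<in> {u0 - Y..u0 + Y}"
  shows "continuous_on {0<..T} (\<lambda>x. f x (w x))"
  unfolding continuous_on_def
proof
  fix a assume a: "a \<in> {0<..T}"
  have "continuous_on {0<..T} (\<lambda>x. L * x powr (\<alpha> - \<beta>) * \<bar>w x - w a\<bar>)"
    by (intro continuous_intros w) auto
  then have "((\<lambda>x. L * x powr (\<alpha> - \<beta>) * \<bar>w x - w a\<bar>) \<longlongrightarrow> L * a powr (\<alpha> - \<beta>) * \<bar>w a - w a\<bar>)
      (at a within {0<..T})"
    using a unfolding continuous_on_def by blast
  then have lim: "((\<lambda>x. L * x powr (\<alpha> - \<beta>) * \<bar>w x - w a\<bar>) \<longlongrightarrow> 0) (at a within {0<..T})"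
    by simp
  have "\<forall>\<^sub>F x in at a within {0<..T}. norm (f x (w x) - f x (w a)) \<le> L * x powr (\<alpha> - \<beta>) * \<bar>w x - w a\<bar>"
    unfolding eventually_at_filter real_norm_def using lip w(2) a
    by (intro always_eventually) (simp add: lipschitz_cond_def)
  then have "((\<lambda>x. f x (w x) - f x (w a)) \<longlongrightarrow> 0) (at a within {0<..T})"
    by (rule Lim_null_comparison[OF _ lim])
  moreover have "((\<lambda>x. f x (w a)) \<longlongrightarrow> f a (w a)) (at a within {0<..T})"
    using cont[OF w(2)[OF a]] a unfolding continuous_on_def by blast
  ultimately show "((\<lambda>x. f x (w x)) \<longlongrightarrow> f a (w a)) (at a within {0<..T})"
    using tendsto_add by fastforce
qed

text \<open>If the level \<open>Y\<close> is exceeded, take the least point where it is attained.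
  Exceeding \<open>Y\<close> earlier would, by the intermediate value theorem, produce a smaller
  such point.\<close>

lemma first_exit_time:
  fixes \<phi> :: "real \<Rightarrow> real"
  assumes T: "0 < T" and \<phi>: "continuous_on {0..T} \<phi>" "\<phi> 0 < Y"
  obtains T' where "T' \<in> {0<..T}" "T' = T \<or> \<phi> T' = Y" "\<And>x. x \<in> {0..T'} \<Longrightarrow> \<phi> x \<le> Y"
proof (cases "\<forall>x\<in>{0..T}. \<phi> x \<le> Y")
  case True
  with T show ?thesis by (intro that[of T]) auto
next
  case False
  define S where "S = {x \<in> {0..T}. \<phi> x = Y}"
  have IVT: "\<exists>y\<in>S. y \<le> x" if x: "x \<in> {0..T}" "Y < \<phi> x" for x
  proof -
    have "\<exists>y\<ge>0. y \<le> x \<and> \<phi> y = Y"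
      by (rule IVT'[OF _ _ _ continuous_on_subset[OF \<phi>(1)]]) (use x \<phi>(2) in auto)
    then show ?thesis using x by (auto simp: S_def)
  qed
  then have "S \<noteq> {}" using False by force
  moreover have "closed S" unfolding S_def
    by (intro continuous_closed_preimage_constant \<phi>) auto
  then have "compact S"
    using compact_Int_closed[of "{0..T}" S] Int_absorb1[of S "{0..T}"] by (simp add: S_def subset_iff)
  ultimately obtain T' where T': "T' \<in> S" "\<And>y. y \<in> S \<Longrightarrow> T' \<le> y"
    using compact_attains_inf[of S] by blast
  have "T' \<noteq> 0" using T'(1) \<phi>(2) by (auto simp: S_def)
  moreover have "\<phi> x \<le> Y" if x: "x \<in> {0..T'}" for x
  proof (rule ccontr)
    assume "\<not> \<phi> x \<le> Y"
    then obtain y where y: "y \<in> S" "y \<le> x" using IVT[of x] x T'(1) by (auto simp: S_def)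
    \<comment> \<open>The crossing satisfies \<open>T' \<le> y \<le> x \<le> T'\<close>, so only
      \<open>x = T'\<close> remains, where the value is exactly \<open>Y\<close>.\<close>
    with T'(2)[of y] x have "x = T'" by simp
    with T'(1) \<open>\<not> \<phi> x \<le> Y\<close> show False by (simp add: S_def)
  qed
  ultimately show ?thesis using T'(1) by (intro that[of T']) (auto simp: S_def)
qed

lemma growth_cond_mono: "growth_cond \<alpha> \<beta> M T u0 Y f \<Longrightarrow> T' \<le> T \<Longrightarrow> growth_cond \<alpha> \<beta> M T' u0 Y f"
  by (simp add: growth_cond_def)

lemma lipschitz_cond_mono: "lipschitz_cond \<alpha> \<beta> L T u0 Y f \<Longrightarrow> T' \<le> T \<Longrightarrow> lipschitz_cond \<alpha> \<beta> L T' u0 Y f"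
  by (simp add: lipschitz_cond_def)

context fractional_order
begin

text \<open>With \<open>G = source f\<close> the initial value problem is equivalent to \<open>u(x) = E[u(xB) + G(xB, u(xB))]\<close>.
  Since \<open>0 powr b = 0\<close>, the source vanishes at \<open>y = 0\<close> whatever \<open>f 0 z\<close> is.\<close>

definition source :: "(real \<Rightarrow> real \<Rightarrow> real) \<Rightarrow> real \<Rightarrow> real \<Rightarrow> real" where
  "source f y z = Gamma (1 - b) * y powr b * f y z"

text \<open>The factor \<open>y powr b\<close> in \<open>source\<close> absorbs the singular part of
  \<open>y powr (\<alpha> - b)\<close>. Growth is the case where \<open>g\<close> is zero, the
  Lipschitz bound is \<open>g = f\<close>, and closeness of two right-hand sides is
  \<open>z' = z\<close>. The bound on \<open>f - g\<close> is asked for positive \<open>y\<close>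
  only, since both sources vanish at 0.\<close>

lemma abs_source_diff_le:
  assumes "y \<in> {0<..T} \<Longrightarrow> \<bar>f y z - g y z'\<bar> \<le> y powr (\<alpha> - b) * c" "y \<in> {0..T}"
  shows "\<bar>source f y z - source g y z'\<bar> \<le> Gamma (1 - b) * y powr \<alpha> * c"
proof (cases "y = 0")
  case False
  with assms(2) have y: "y \<in> {0<..T}" by simp
  have G: "0 < Gamma (1 - b)" using b by (intro Gamma_real_pos) simp
  have "\<bar>source f y z - source g y z'\<bar> = Gamma (1 - b) * y powr b * \<bar>f y z - g y z'\<bar>"
    using G by (simp add: source_def right_diff_distrib[symmetric] abs_mult)
  also have "\<dots> \<le> Gamma (1 - b) * y powr b * (y powr (\<alpha> - b) * c)"
    using assms(1)[OF y] G by (intro mult_left_mono) auto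
  also have "y powr b * y powr (\<alpha> - b) = y powr \<alpha>" by (simp add: powr_add[symmetric])
  then have "Gamma (1 - b) * y powr b * (y powr (\<alpha> - b) * c) = Gamma (1 - b) * y powr \<alpha> * c"
    by (simp add: mult.assoc[symmetric])
  finally show ?thesis .
qed (use b in \<open>simp add: source_def\<close>)

lemma abs_source_le:
  assumes "growth_cond \<alpha> b M T u0 Y f" "y \<in> {0..T}" "z \<in> {u0 - Y..u0 + Y}"
  shows "\<bar>source f y z\<bar> \<le> (Gamma (1 - b) * M) * y powr \<alpha>"
  using abs_source_diff_le[of y T f z "\<lambda>_ _. 0" z \<alpha> M] assms
  by (simp add: growth_cond_def source_def mult_ac)

lemma source_lipschitz:
  assumes "lipschitz_cond \<alpha> b L T u0 Y f" "y \<in> {0..T}" "z \<in> {u0 - Y..u0 + Y}" "z' \<in> {u0 - Y..u0 + Y}"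
  shows "\<bar>source f y z - source f y z'\<bar> \<le> (Gamma (1 - b) * L) * y powr \<alpha> * \<bar>z - z'\<bar>"
  using abs_source_diff_le[of y T f z f z' \<alpha> "L * \<bar>z - z'\<bar>"] assms
  by (simp add: lipschitz_cond_def mult_ac)

text \<open>Continuity of the source along \<open>u\<close> is read off from the equation, not from
  continuity of \<open>f\<close>: up to the censoring term, \<open>f x (u x)\<close> is the
  continuous derivative of \<open>J0 b u\<close>. The growth bound extends the continuity to
  0.\<close>

lemma solution_mild:
  assumes T: "0 < T" and \<alpha>: "0 < \<alpha>" and gr: "growth_cond \<alpha> b M T u0 Y f"
    and sol: "solves_ivp b T u0 Y f u"
  shows "continuous_on {0..T} (\<lambda>y. source f y (u y))"
    and "x \<in> {0<..T} \<Longrightarrow> u x = beta_avg b (\<lambda>y. u y + source f y (u y)) x"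
proof -
  have uC: "u \<in> C_beta b T" and uY: "\<And>x. x \<in> {0..T} \<Longrightarrow> u x \<in> {u0 - Y..u0 + Y}"
    and eq: "\<And>x. x \<in> {0<..T} \<Longrightarrow> censored_deriv b T u x = f x (u x)"
    using sol by (simp_all add: solves_ivp_def)
  have uc: "continuous_on {0..T} u" using uC by (simp add: C_beta_def)
  have src: "censored_deriv b T u x = x powr (-b) / Gamma (1 - b) * (u x + source f x (u x) - u x)"
    if "x \<in> {0<..T}" for x
    using that eq[OF that] Gamma_order_nonzero by (simp add: source_def powr_minus)
  obtain F where F: "continuous_on {0<..T} F"
      "\<And>x. x \<in> {0<..T} \<Longrightarrow> (J0 b u has_real_derivative F x) (at x within {0<..T})"
    using uC unfolding C_beta_def C_beta_left_open_def C1_left_open_def by blast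
  show c: "continuous_on {0..T} (\<lambda>y. source f y (u y))"
  proof (rule continuous_on_Icc_of_powr_bound[OF _ \<alpha>])
    have "continuous_on {0<..T} (\<lambda>x. Gamma (1 - b) * x powr b * (F x - x powr (-b) / Gamma (1 - b) * u x))"
      using Gamma_order_nonzero by (intro continuous_intros F(1) continuous_on_subset[OF uc]) auto
    then show "continuous_on {0<..T} (\<lambda>y. source f y (u y))"
    proof (rule continuous_on_cong[THEN iffD1, OF refl, rotated])
      fix x assume x: "x \<in> {0<..T}"
      show "Gamma (1 - b) * x powr b * (F x - x powr (-b) / Gamma (1 - b) * u x) = source f x (u x)"
        using censored_deriv_eqI[OF F(2)[OF x] x] eq[OF x] by (simp add: source_def)
    qed
    show "\<bar>source f y (u y)\<bar> \<le> (Gamma (1 - b) * M) * y powr \<alpha>" if "y \<in> {0..T}" for y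
      by (rule abs_source_le[OF gr that uY[OF that]])
  qed
  show "u x = beta_avg b (\<lambda>y. u y + source f y (u y)) x" if "x \<in> {0<..T}"
    by (rule fixed_point_of_C_beta_solution[OF T _ uC src that]) (intro continuous_intros uc c)
qed

text \<open>Split the difference of the sources into \<open>f\<close> at \<open>u\<close> and at
  \<open>v\<close>, controlled by the Lipschitz bound, and \<open>f\<close> against \<open>g\<close>
  at \<open>v\<close>, controlled by \<open>e\<close>. The constant is obtained before the data are
  quantified, so it is uniform in \<open>u0\<close>, \<open>Y\<close>, \<open>M\<close>,
  \<open>f\<close> and \<open>g\<close>.\<close>

lemma continuous_dependence:
  assumes T: "0 < T" and \<alpha>: "0 < \<alpha>" and L: "0 \<le> L"
  obtains C where "\<And>u0 Y M f g u v e x. \<lbrakk>growth_cond \<alpha> b M T u0 Y f; growth_cond \<alpha> b M T u0 Y g;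
      lipschitz_cond \<alpha> b L T u0 Y f; solves_ivp b T u0 Y f u; solves_ivp b T u0 Y g v;
      0 \<le> e; \<And>x y. \<lbrakk>x \<in> {0<..T}; y \<in> {u0 - Y..u0 + Y}\<rbrakk> \<Longrightarrow> \<bar>f x y - g x y\<bar> \<le> x powr (\<alpha> - b) * e;
      x \<in> {0..T}\<rbrakk> \<Longrightarrow> \<bar>u x - v x\<bar> \<le> C * e"
proof -
  define c where "c = Gamma (1 - b)"
  have c: "0 < c" using b by (simp add: c_def Gamma_real_pos)
  obtain k q where kq: "0 \<le> k" "0 \<le> q" "q < 1"
    and contr: "\<And>x. x \<in> {0..T} \<Longrightarrow> beta_avg b (\<lambda>y. (1 + (c * L) * y powr \<alpha>) * (y powr \<alpha> * exp (k * y))) x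
       \<le> q * (x powr \<alpha> * exp (k * x))"
    using beta_avg_contraction[OF \<alpha> _ T, of "c * L"] c L by auto
  show ?thesis
  \<comment> \<open>The Gronwall bound evaluated at \<open>x = T\<close>, where the weight is
    largest.\<close>
  proof (rule that[of "c / (1 - q) * (T powr \<alpha> * exp (k * T))"])
    fix u0 Y M f g u v e x
    assume gr: "growth_cond \<alpha> b M T u0 Y f" "growth_cond \<alpha> b M T u0 Y g"
      and lip: "lipschitz_cond \<alpha> b L T u0 Y f"
      and u: "solves_ivp b T u0 Y f u" and v: "solves_ivp b T u0 Y g v"
      and e: "0 \<le> e" and close: "\<And>x y. \<lbrakk>x \<in> {0<..T}; y \<in> {u0 - Y..u0 + Y}\<rbrakk> \<Longrightarrow> \<bar>f x y - g x y\<bar> \<le> x powr (\<alpha> - b) * e"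
      and x: "x \<in> {0..T}"
    have uc: "continuous_on {0..T} u" and vc: "continuous_on {0..T} v"
      and uY: "\<And>x. x \<in> {0..T} \<Longrightarrow> u x \<in> {u0 - Y..u0 + Y}" and vY: "\<And>x. x \<in> {0..T} \<Longrightarrow> v x \<in> {u0 - Y..u0 + Y}"
      and init: "u 0 = v 0"
      using u v by (simp_all add: solves_ivp_def C_beta_def)
    note um = solution_mild[OF T \<alpha> gr(1) u] and vm = solution_mild[OF T \<alpha> gr(2) v]
    have "\<bar>u x - v x\<bar> \<le> (c * e) / (1 - q) * (x powr \<alpha> * exp (k * x))"
    proof (rule beta_avg_Gronwall[OF \<alpha> _ T kq contr _ _ _ _ x])
      fix x assume x: "x \<in> {0<..T}"
      show "\<bar>u x - v x\<bar> \<le> beta_avg b (\<lambda>y. (1 + (c * L) * y powr \<alpha>) * \<bar>u y - v y\<bar> + (c * e) * y powr \<alpha>) x"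
        unfolding um(2)[OF x] vm(2)[OF x]
      proof (rule abs_beta_avg_diff_le[of T])
        fix y assume y: "y \<in> {0..T}"
        have "\<bar>source f y (u y) - source f y (v y)\<bar> \<le> (c * L) * y powr \<alpha> * \<bar>u y - v y\<bar>"
          using source_lipschitz[OF lip y uY[OF y] vY[OF y]] by (simp add: c_def)
        moreover have "\<bar>source f y (v y) - source g y (v y)\<bar> \<le> c * y powr \<alpha> * e"
          unfolding c_def by (rule abs_source_diff_le[OF _ y]) (rule close[OF _ vY[OF y]])
        ultimately show "\<bar>(u y + source f y (u y)) - (v y + source g y (v y))\<bar>
            \<le> (1 + (c * L) * y powr \<alpha>) * \<bar>u y - v y\<bar> + (c * e) * y powr \<alpha>"
          by (simp add: algebra_simps)
      qed (use x \<alpha> in \<open>auto intro!: continuous_intros uc vc um vm\<close>)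
    qed (use c L e init in \<open>auto intro!: continuous_intros uc vc\<close>)
    also have "\<dots> \<le> (c * e) / (1 - q) * (T powr \<alpha> * exp (k * T))"
      using c e kq x \<alpha> by (intro mult_left_mono mult_mono powr_mono2) (auto simp: mult_left_mono)
    finally show "\<bar>u x - v x\<bar> \<le> c / (1 - q) * (T powr \<alpha> * exp (k * T)) * e"
      by (simp add: mult_ac)
  qed
qed

text \<open>Stability with \<open>g = f\<close> and \<open>e = 0\<close>.\<close>

lemma solution_unique:
  assumes "0 < T" "0 < \<alpha>" "0 \<le> L" "growth_cond \<alpha> b M T u0 Y f" "lipschitz_cond \<alpha> b L T u0 Y f"
    and "solves_ivp b T u0 Y f u" "solves_ivp b T u0 Y f v" "x \<in> {0..T}"
  shows "v x = u x"
proof -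
  obtain C where C: "\<And>u0 Y M f g u v e x. \<lbrakk>growth_cond \<alpha> b M T u0 Y f; growth_cond \<alpha> b M T u0 Y g;
      lipschitz_cond \<alpha> b L T u0 Y f; solves_ivp b T u0 Y f u; solves_ivp b T u0 Y g v;
      0 \<le> e; \<And>x y. \<lbrakk>x \<in> {0<..T}; y \<in> {u0 - Y..u0 + Y}\<rbrakk> \<Longrightarrow> \<bar>f x y - g x y\<bar> \<le> x powr (\<alpha> - b) * e;
      x \<in> {0..T}\<rbrakk> \<Longrightarrow> \<bar>u x - v x\<bar> \<le> C * e"
    using continuous_dependence[OF assms(1-3)] by metis
  from C[OF assms(4,4,5,6,7), of 0 x] assms(8) show ?thesis by simp
qed

text \<open>Clamping is 1-Lipschitz with values in the strip, so the clamped source satisfies the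
  growth and Lipschitz bounds for every real \<open>z\<close>, as the fixed point lemma
  requires.\<close>

lemma solution_exists:
  assumes T: "0 < T" and \<alpha>: "0 < \<alpha>" and L: "0 \<le> L" and Y: "0 < Y"
    and cont: "\<And>y. y \<in> {u0 - Y..u0 + Y} \<Longrightarrow> continuous_on {0<..T} (\<lambda>x. f x y)"
    and gr: "growth_cond \<alpha> b M T u0 Y f" and lip: "lipschitz_cond \<alpha> b L T u0 Y f"
  obtains T' u where "T' \<in> {0<..T}" "T' = T \<or> u T' \<in> {u0 - Y, u0 + Y}" "solves_ivp b T' u0 Y f u"
proof -
  define clamp where "clamp z = max (u0 - Y) (min (u0 + Y) z)" for z
  have clamp: "clamp z \<in> {u0 - Y..u0 + Y}" for z using Y by (simp add: clamp_def)
  have clamp_lip: "\<bar>clamp z - clamp z'\<bar> \<le> \<bar>z - z'\<bar>" for z z' by (auto simp: clamp_def max_def min_def)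
  define G where "G y z = source f y (clamp z)" for y z
  have Gc: "continuous_on {0..T} (\<lambda>y. G y (w y))" if w: "continuous_on {0..T} w" for w
    unfolding G_def
  proof (rule continuous_on_Icc_of_powr_bound[OF _ \<alpha>])
    have "continuous_on {0<..T} (\<lambda>y. f y (clamp (w y)))"
      by (rule continuous_on_lipschitz_compose[OF cont lip _ clamp])
        (auto simp: clamp_def intro!: continuous_intros continuous_on_subset[OF w])
    then show "continuous_on {0<..T} (\<lambda>y. source f y (clamp (w y)))"
      unfolding source_def by (intro continuous_intros) auto
    show "\<bar>source f y (clamp (w y))\<bar> \<le> (Gamma (1 - b) * M) * y powr \<alpha>" if "y \<in> {0..T}" for y
      by (rule abs_source_le[OF gr that clamp])
  qed
  have c: "0 < Gamma (1 - b)" using b by (intro Gamma_real_pos) simp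
  then have cL: "0 \<le> Gamma (1 - b) * L" using L by simp
  have Gb: "\<bar>G y z\<bar> \<le> (Gamma (1 - b) * M) * y powr \<alpha>" if "y \<in> {0..T}" for y z
    unfolding G_def by (rule abs_source_le[OF gr that clamp])
  have Gl: "\<bar>G y z - G y z'\<bar> \<le> (Gamma (1 - b) * L) * y powr \<alpha> * \<bar>z - z'\<bar>" if y: "y \<in> {0..T}" for y z z'
  proof -
    have "\<bar>G y z - G y z'\<bar> \<le> (Gamma (1 - b) * L) * y powr \<alpha> * \<bar>clamp z - clamp z'\<bar>"
      unfolding G_def by (rule source_lipschitz[OF lip y clamp clamp])
    also have "\<dots> \<le> (Gamma (1 - b) * L) * y powr \<alpha> * \<bar>z - z'\<bar>"
      using c L by (intro mult_left_mono clamp_lip) auto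
    finally show ?thesis .
  qed
  obtain u where uc: "continuous_on {0..T} u" and u0: "u 0 = u0"
    and fp: "\<And>x. x \<in> {0..T} \<Longrightarrow> u x = beta_avg b (\<lambda>y. u y + G y (u y)) x"
    using beta_avg_fixed_point[OF \<alpha> cL T Gc Gb Gl, where ?u0.0 = u0] by blast
  have "continuous_on {0..T} (\<lambda>x. \<bar>u x - u0\<bar>)" by (intro continuous_intros uc)
  moreover have "\<bar>u 0 - u0\<bar> < Y" using u0 Y by simp
  ultimately obtain T' where T': "T' \<in> {0<..T}" "T' = T \<or> \<bar>u T' - u0\<bar> = Y"
    and uY: "\<And>x. x \<in> {0..T'} \<Longrightarrow> \<bar>u x - u0\<bar> \<le> Y"
    using first_exit_time[OF T, of "\<lambda>x. \<bar>u x - u0\<bar>" Y] by blast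
  have sub: "{0..T'} \<subseteq> {0..T}" using T' by auto
  have uc': "continuous_on {0..T'} u" by (rule continuous_on_subset[OF uc sub])
  have pc: "continuous_on {0..T'} (\<lambda>y. u y + G y (u y))"
    by (rule continuous_on_subset[OF _ sub]) (intro continuous_intros uc Gc)
  have T'0: "0 < T'" using T' by simp
  \<comment> \<open>The averaged equation at \<open>x\<close> involves no values beyond
    \<open>x\<close>, so it restricts to \<open>{0..T'}\<close>; the derivative at \<open>T'\<close>
    is then one-sided from the outset.\<close>
  have fp': "u x = beta_avg b (\<lambda>y. u y + G y (u y)) x" if "x \<in> {0..T'}" for x
    using that sub by (intro fp) auto
  have sol: "u \<in> C_beta b T'"
    by (rule C_beta_solution_of_fixed_point(1)[OF pc uc' fp'])
  have eq: "censored_deriv b T' u x = x powr (-b) / Gamma (1 - b) * (u x + G x (u x) - u x)"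
    if "x \<in> {0<..T'}" for x
    by (rule C_beta_solution_of_fixed_point(2)[OF pc uc' fp' that])
  have "solves_ivp b T' u0 Y f u"
    unfolding solves_ivp_def
  proof (intro conjI ballI)
    show "u x \<in> {u0 - Y..u0 + Y}" if "x \<in> {0..T'}" for x
      using uY[OF that] by (auto simp: abs_le_iff)
    show "censored_deriv b T' u x = f x (u x)" if x: "x \<in> {0<..T'}" for x
    proof -
      \<comment> \<open>Up to the exit time the clamp is inactive, so the original \<open>f\<close>
        reappears.\<close>
      have "clamp (u x) = u x" using uY[of x] x by (auto simp: clamp_def abs_le_iff)
      then show ?thesis
        using eq[OF x] x Gamma_order_nonzero by (simp add: G_def source_def powr_minus)
    qed
  qed (use sol u0 in auto)
  moreover have "T' = T \<or> u T' \<in> {u0 - Y, u0 + Y}" using T'(2) by (auto simp: abs_if split: if_splits)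
  ultimately show ?thesis using T'(1) that by blast
qed

end

theorem proposition3p9:
  fixes \<alpha> \<beta> L T :: real
  assumes "0 < \<beta>" "\<beta> < 1" "0 < T" "0 < \<alpha>" "0 < L"
  shows
    "(\<forall>(u0::real) (Y::real) (M::real) (f::real \<Rightarrow> real \<Rightarrow> real).
        0 < Y \<longrightarrow> 0 < M \<longrightarrow>
        (\<forall>y\<in>{u0 - Y..u0 + Y}. continuous_on {0<..T} (\<lambda>x. f x y)) \<longrightarrow>
        growth_cond \<alpha> \<beta> M T u0 Y f \<longrightarrow>
        lipschitz_cond \<alpha> \<beta> L T u0 Y f \<longrightarrow>
        (\<exists>T' u. (T' = T \<or> (T' \<in> {0<..<T} \<and> u T' \<in> {u0 - Y, u0 + Y})) \<and>
           solves_ivp \<beta> T' u0 Y f u \<and>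
           (\<forall>v. solves_ivp \<beta> T' u0 Y f v \<longrightarrow> (\<forall>x\<in>{0..T'}. v x = u x))))
     \<and>
     (\<exists>C::real. \<forall>(u0::real) (Y::real) (M::real) (f::real \<Rightarrow> real \<Rightarrow> real) (g::real \<Rightarrow> real \<Rightarrow> real)
          (u::real \<Rightarrow> real) (v::real \<Rightarrow> real).
        0 < Y \<longrightarrow> 0 < M \<longrightarrow>
        growth_cond \<alpha> \<beta> M T u0 Y f \<longrightarrow> lipschitz_cond \<alpha> \<beta> L T u0 Y f \<longrightarrow>
        growth_cond \<alpha> \<beta> M T u0 Y g \<longrightarrow> lipschitz_cond \<alpha> \<beta> L T u0 Y g \<longrightarrow>
        solves_ivp \<beta> T u0 Y f u \<longrightarrow> solves_ivp \<beta> T u0 Y g v \<longrightarrow>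
        (SUP x\<in>{0..T}. \<bar>u x - v x\<bar>)
          \<le> C * (SUP (x, y)\<in>{0<..T} \<times> {u0 - Y..u0 + Y}. x powr (\<beta> - \<alpha>) * \<bar>f x y - g x y\<bar>))"
proof -
  interpret fractional_order \<beta> by unfold_locales (use assms in auto)
  \<comment> \<open>Fixing \<open>C\<close> before \<open>u0\<close>, \<open>Y\<close>,
    \<open>M\<close>, \<open>f\<close> and \<open>g\<close> expresses that it depends only on
    \<open>\<alpha>\<close>, \<open>\<beta>\<close>, \<open>L\<close> and \<open>T\<close>.\<close>
  obtain C where C: "\<And>u0 Y M f g u v e x. \<lbrakk>growth_cond \<alpha> \<beta> M T u0 Y f; growth_cond \<alpha> \<beta> M T u0 Y g;
      lipschitz_cond \<alpha> \<beta> L T u0 Y f; solves_ivp \<beta> T u0 Y f u; solves_ivp \<beta> T u0 Y g v;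
      0 \<le> e; \<And>x y. \<lbrakk>x \<in> {0<..T}; y \<in> {u0 - Y..u0 + Y}\<rbrakk> \<Longrightarrow> \<bar>f x y - g x y\<bar> \<le> x powr (\<alpha> - \<beta>) * e;
      x \<in> {0..T}\<rbrakk> \<Longrightarrow> \<bar>u x - v x\<bar> \<le> C * e"
    using continuous_dependence[of T \<alpha> L] assms by (metis less_imp_le)
  show ?thesis
  proof (rule conjI; (rule exI[of _ C])?; intro allI impI)
    fix u0 Y M f
    assume Y: "0 < Y" and cont: "\<forall>y\<in>{u0 - Y..u0 + Y}. continuous_on {0<..T} (\<lambda>x. f x y)"
      and gr: "growth_cond \<alpha> \<beta> M T u0 Y f" and lip: "lipschitz_cond \<alpha> \<beta> L T u0 Y f"
    obtain T' u where T': "T' \<in> {0<..T}" "T' = T \<or> u T' \<in> {u0 - Y, u0 + Y}" and u: "solves_ivp \<beta> T' u0 Y f u"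
      using solution_exists[OF assms(3,4) less_imp_le[OF assms(5)] Y _ gr lip] cont by blast
    have "v x = u x" if "solves_ivp \<beta> T' u0 Y f v" "x \<in> {0..T'}" for v x
      using T'(1) assms that u
      by (intro solution_unique[of T' \<alpha> L M u0 Y f] growth_cond_mono[OF gr] lipschitz_cond_mono[OF lip]) auto
    moreover have "T' = T \<or> (T' \<in> {0<..<T} \<and> u T' \<in> {u0 - Y, u0 + Y})"
      using T' by auto
    ultimately show "\<exists>T' u. (T' = T \<or> (T' \<in> {0<..<T} \<and> u T' \<in> {u0 - Y, u0 + Y})) \<and>
           solves_ivp \<beta> T' u0 Y f u \<and>
           (\<forall>v. solves_ivp \<beta> T' u0 Y f v \<longrightarrow> (\<forall>x\<in>{0..T'}. v x = u x))"
      using u by blast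
  next
    fix u0 Y M :: real and f g u v
    assume Y: "0 < Y"
      and f: "growth_cond \<alpha> \<beta> M T u0 Y f" "lipschitz_cond \<alpha> \<beta> L T u0 Y f"
      and g: "growth_cond \<alpha> \<beta> M T u0 Y g"
      and u: "solves_ivp \<beta> T u0 Y f u" and v: "solves_ivp \<beta> T u0 Y g v"
    define D where "D = (\<lambda>(x, y). x powr (\<beta> - \<alpha>) * \<bar>f x y - g x y\<bar>)"
    define Q where "Q = {0<..T} \<times> {u0 - Y..u0 + Y}"
    have inv: "x powr (\<alpha> - \<beta>) * x powr (\<beta> - \<alpha>) = 1" if "0 < x" for x :: real
      using that by (simp add: powr_add[symmetric])
    \<comment> \<open>A supremum of reals bounds its set only if the set is bounded above; the two
      growth conditions provide the bound \<open>2 * M\<close>.\<close>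
    have bdd: "bdd_above (D ` Q)"
    proof (rule bdd_aboveI2)
      fix z assume "z \<in> Q"
      then obtain x y where z: "z = (x, y)" "x \<in> {0<..T}" "y \<in> {u0 - Y..u0 + Y}" by (auto simp: Q_def)
      then have "\<bar>f x y\<bar> \<le> M * x powr (\<alpha> - \<beta>)" "\<bar>g x y\<bar> \<le> M * x powr (\<alpha> - \<beta>)"
        using f(1) g by (auto simp: growth_cond_def)
      then have "\<bar>f x y - g x y\<bar> \<le> 2 * M * x powr (\<alpha> - \<beta>)" by linarith
      then have "x powr (\<beta> - \<alpha>) * \<bar>f x y - g x y\<bar> \<le> x powr (\<beta> - \<alpha>) * (2 * M * x powr (\<alpha> - \<beta>))"
        by (intro mult_left_mono) auto
      also have "\<dots> = 2 * M" using inv[of x] z by (simp add: mult_ac)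
      finally show "D z \<le> 2 * M" by (simp add: D_def z)
    qed
    define e where "e = (SUP z\<in>Q. D z)"
    have le: "D (x, y) \<le> e" if "x \<in> {0<..T}" "y \<in> {u0 - Y..u0 + Y}" for x y
      unfolding e_def using that by (intro cSUP_upper bdd) (auto simp: Q_def)
    have close: "\<bar>f x y - g x y\<bar> \<le> x powr (\<alpha> - \<beta>) * e" if "x \<in> {0<..T}" "y \<in> {u0 - Y..u0 + Y}" for x y
    proof -
      have "x powr (\<alpha> - \<beta>) * D (x, y) \<le> x powr (\<alpha> - \<beta>) * e"
        using le[OF that] by (intro mult_left_mono) auto
      moreover have "x powr (\<alpha> - \<beta>) * D (x, y) = \<bar>f x y - g x y\<bar>"
        using inv[of x] that by (simp add: D_def mult.assoc[symmetric])
      ultimately show ?thesis by simp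
    qed
    \<comment> \<open>Any point of \<open>Q\<close> shows that the supremum is nonnegative;
      \<open>(T, u0)\<close> is one because \<open>T\<close> and \<open>Y\<close> are
      positive.\<close>
    have "0 \<le> D (T, u0)" by (simp add: D_def)
    also have "\<dots> \<le> e" using assms(3) Y by (intro le) auto
    finally have e: "0 \<le> e" .
    have "(SUP x\<in>{0..T}. \<bar>u x - v x\<bar>) \<le> C * e"
      using assms(3) by (intro cSUP_least C[OF f(1) g f(2) u v e close]) auto
    then show "(SUP x\<in>{0..T}. \<bar>u x - v x\<bar>)
        \<le> C * (SUP (x, y)\<in>{0<..T} \<times> {u0 - Y..u0 + Y}. x powr (\<beta> - \<alpha>) * \<bar>f x y - g x y\<bar>)"
      by (simp add: e_def D_def Q_def)
  qed
qed

end
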